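(* Let $q\in\mathbb{C}\setminus\{0\}$ be not a root of unity, and consider any of the four $U_q(\mathfrak{sl}_2)$-module algebra structures on the quantum plane $\mathbb{C}_q[x,y]$ given by $\mathsf{k}(x)=\pm x$, $\mathsf{k}(y)=\pm y$ (independent signs), $\mathsf{e}(x)=\mathsf{e}(y)=\mathsf{f}(x)=\mathsf{f}(y)=0$. Viewed as a representation of $U_q(\mathfrak{sl}_2)$ in the vector space $\mathbb{C}_q[x,y]$, it splits into the direct sum $$\mathbb{C}_q[x,y]=\bigoplus_{m=0}^\infty\bigoplus_{n=0}^\infty\mathbb{C}x^my^n$$ of (irreducible) one-dimensional subrepresentations. These subrepresentations may belong to two isomorphism classes, depending on the weight of the monomial $x^my^n$, which can be $1$ or $-1$.
   Context: The quantum plane $\mathbb{C}_q[x,y]$ is the unital associative $\mathbb{C}$-algebra with generators $x,y$ and the single relation $yx=qxy$; the monomials $x^my^n$ ($m,n\ge 0$) form a basis. $U_q(\mathfrak{sl}_2)$ is the unital associative $\mathbb{C}$-algebra with generators $\mathsf{k},\mathsf{k}^{-1},\mathsf{e},\mathsf{f}$ and relations $\mathsf{k}^{-1}\mathsf{k}=\mathsf{k}\mathsf{k}^{-1}=\mathbf{1}$, $\mathsf{k}\mathsf{e}=q^2\mathsf{e}\mathsf{k}$, $\mathsf{k}\mathsf{f}=q^{-2}\mathsf{f}\mathsf{k}$, $\mathsf{e}\mathsf{f}-\mathsf{f}\mathsf{e}=\frac{\mathsf{k}-\mathsf{k}^{-1}}{q-q^{-1}}$, with comultiplication $\Delta(\mathsf{k})=\mathsf{k}\otimes\mathsf{k}$,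 $\Delta(\mathsf{e})=\mathbf{1}\otimes\mathsf{e}+\mathsf{e}\otimes\mathsf{k}$, $\Delta(\mathsf{f})=\mathsf{f}\otimes\mathbf{1}+\mathsf{k}^{-1}\otimes\mathsf{f}$ and counit $\varepsilon(\mathsf{k})=1$, $\varepsilon(\mathsf{e})=\varepsilon(\mathsf{f})=0$. A $U_q(\mathfrak{sl}_2)$-module algebra structure on $A=\mathbb{C}_q[x,y]$ is an algebra homomorphism $\pi:U_q(\mathfrak{sl}_2)\to\operatorname{End}_{\mathbb{C}}A$ such that $\pi(h)(ab)=\sum_i\pi(h_i')(a)\,\pi(h_i'')(b)$ (where $\Delta(h)=\sum_i h_i'\otimes h_i''$) and $\pi(h)(\mathbf{1})=\varepsilon(h)\mathbf{1}$ for all $h$ and all $a,b\in A$; one writes $h(a)$ for $\pi(h)(a)$. It is uniquely determined by the values of $\mathsf{k},\mathsf{e},\mathsf{f}$ on $x,y$. If $\mathsf{k}(x)=\alpha x$, $\mathsf{k}(y)=\beta y$, the weight of the monomial $x^my^n$ is its $\mathsf{k}$-eigenvalue $\alpha^m\beta^n$. The final assertion means that two of the one-dimensional summands are isomorphic as representations if and only if the corresponding monomials have the same weight, which is always $1$ or $-1$. *)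

theory Defs
  imports
    "Jordan_Normal_Form.VS_Connect"
    "HOL-Algebra.QuotRing"
    "HOL-Library.Poly_Mapping"
    "HOL-Library.Product_Plus"
begin

section \<open>Algebras given by generators and relations\<close>

text \<open>Words form a monoid under concatenation, written additively so that
  finitely supported functions on words, with the convolution product of
  \<^theory>\<open>HOL-Library.Poly_Mapping\<close>, are the free associative algebra. In the same way
  \<open>'g list \<times> 'g list \<Rightarrow>\<^sub>0 complex\<close> is the tensor square of the free algebra on \<open>'g\<close>.\<close>

instantiation list :: (type) monoid_add
begin
definition zero_list :: "'a list" where "zero_list = []"
definition plus_list :: "'a list \<Rightarrow> 'a list \<Rightarrow> 'a list" where "plus_list = (@)"
instance by standard (simp_all add: zero_list_def plus_list_def)
end

type_synonym 'g free_alg = "'g list \<Rightarrow>\<^sub>0 complex"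

type_synonym 'g free_alg2 = "'g list \<times> 'g list \<Rightarrow>\<^sub>0 complex"

definition gen :: "'g \<Rightarrow> 'g free_alg"
  where "gen g = Poly_Mapping.single [g] 1"

abbreviation const :: "complex \<Rightarrow> ('m::monoid_add \<Rightarrow>\<^sub>0 complex)"
  where "const c \<equiv> Poly_Mapping.single 0 c"

definition tens :: "'g free_alg \<Rightarrow> 'g free_alg \<Rightarrow> 'g free_alg2"
  where "tens a b =
    (\<Sum>u\<in>Poly_Mapping.keys a. \<Sum>v\<in>Poly_Mapping.keys b.
      Poly_Mapping.single (u, v) (Poly_Mapping.lookup a u * Poly_Mapping.lookup b v))"

text \<open>The algebra homomorphism on the free algebra with values \<open>\<phi>\<close> on the generators, for a
  central embedding \<open>s\<close> of the scalars into the target.\<close>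

definition free_lift :: "(complex \<Rightarrow> 'b::ring_1) \<Rightarrow> ('g \<Rightarrow> 'b) \<Rightarrow> 'g free_alg \<Rightarrow> 'b"
  where "free_lift s \<phi> h = (\<Sum>w\<in>Poly_Mapping.keys h. s (Poly_Mapping.lookup h w) * prod_list (map \<phi> w))"

definition rel_class :: "('m::monoid_add \<Rightarrow>\<^sub>0 complex) set \<Rightarrow> ('m \<Rightarrow>\<^sub>0 complex) \<Rightarrow> ('m \<Rightarrow>\<^sub>0 complex) set"
  where "rel_class S a = Idl\<^bsub>class_ring\<^esub> S +>\<^bsub>class_ring\<^esub> a"

text \<open>\<^const>\<open>genideal\<close> is the two-sided ideal generated by a set. As for \<^const>\<open>rcoset_mult\<close>,
  the union over all representatives is a single coset.\<close>

definition quot_alg :: "('m::monoid_add \<Rightarrow>\<^sub>0 complex) set \<Rightarrow> (complex, ('m \<Rightarrow>\<^sub>0 complex) set) module"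
  where "quot_alg S = ring.extend (class_ring Quot (Idl\<^bsub>class_ring\<^esub> S))
    (module.fields (\<lambda>c X. \<Union>a\<in>X. rel_class S (const c * a)))"

section \<open>The quantum plane\<close>

datatype qp_gen = Gen_x | Gen_y

definition qp_rels :: "complex \<Rightarrow> qp_gen free_alg set"
  where "qp_rels q = {gen Gen_y * gen Gen_x - const q * gen Gen_x * gen Gen_y}"

definition qplane :: "complex \<Rightarrow> (complex, qp_gen free_alg set) module"
  where "qplane q = quot_alg (qp_rels q)"

definition qp_x :: "complex \<Rightarrow> qp_gen free_alg set"
  where "qp_x q = rel_class (qp_rels q) (gen Gen_x)"

definition qp_y :: "complex \<Rightarrow> qp_gen free_alg set"
  where "qp_y q = rel_class (qp_rels q) (gen Gen_y)"

definition qp_mono :: "complex \<Rightarrow> nat \<Rightarrow> nat \<Rightarrow> qp_gen free_alg set"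
  where "qp_mono q m n =
    (qp_x q [^]\<^bsub>qplane q\<^esub> m) \<otimes>\<^bsub>qplane q\<^esub> (qp_y q [^]\<^bsub>qplane q\<^esub> n)"

section \<open>The quantum group\<close>

datatype uq_gen = Gen_k | Gen_kinv | Gen_e | Gen_f

definition uq_rels :: "complex \<Rightarrow> uq_gen free_alg set"
  where "uq_rels q = (let k = gen Gen_k; k' = gen Gen_kinv; e = gen Gen_e; f = gen Gen_f in
    {k' * k - 1, k * k' - 1,
     k * e - const (q^2) * e * k,
     k * f - const (inverse (q^2)) * f * k,
     e * f - f * e - const (1 / (q - inverse q)) * (k - k')})"

definition Uq :: "complex \<Rightarrow> (complex, uq_gen free_alg set) module"
  where "Uq q = quot_alg (uq_rels q)"

definition uq_class :: "complex \<Rightarrow> uq_gen free_alg \<Rightarrow> uq_gen free_alg set"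
  where "uq_class q = rel_class (uq_rels q)"

definition uq_k :: "complex \<Rightarrow> uq_gen free_alg set"
  where "uq_k q = uq_class q (gen Gen_k)"

definition uq_e :: "complex \<Rightarrow> uq_gen free_alg set"
  where "uq_e q = uq_class q (gen Gen_e)"

definition uq_f :: "complex \<Rightarrow> uq_gen free_alg set"
  where "uq_f q = uq_class q (gen Gen_f)"

text \<open>If the free algebra modulo the ideal \<open>I\<close> is \<open>U\<close>, then its tensor square modulo the ideal
  generated by \<open>r \<otimes> 1\<close> and \<open>1 \<otimes> r\<close>, for \<open>r\<close> in a generating set of \<open>I\<close>, is \<open>U \<otimes> U\<close>.\<close>

definition uq2_rels :: "complex \<Rightarrow> uq_gen free_alg2 set"
  where "uq2_rels q = (\<lambda>r. tens r 1) ` uq_rels q \<union> tens 1 ` uq_rels q"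

definition uq2_class :: "complex \<Rightarrow> uq_gen free_alg2 \<Rightarrow> uq_gen free_alg2 set"
  where "uq2_class q = rel_class (uq2_rels q)"

fun comult_gen :: "uq_gen \<Rightarrow> uq_gen free_alg2" where
  "comult_gen Gen_k = tens (gen Gen_k) (gen Gen_k)"
| "comult_gen Gen_kinv = tens (gen Gen_kinv) (gen Gen_kinv)"
| "comult_gen Gen_e = tens 1 (gen Gen_e) + tens (gen Gen_e) (gen Gen_k)"
| "comult_gen Gen_f = tens (gen Gen_f) 1 + tens (gen Gen_kinv) (gen Gen_f)"

fun counit_gen :: "uq_gen \<Rightarrow> complex" where
  "counit_gen Gen_k = 1"
| "counit_gen Gen_kinv = 1"
| "counit_gen Gen_e = 0"
| "counit_gen Gen_f = 0"

text \<open>Both maps are constant on cosets; see \<open>uq_comult_class\<close> and \<open>uq_counit_class\<close> below.\<close>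

definition uq_comult :: "complex \<Rightarrow> uq_gen free_alg set \<Rightarrow> uq_gen free_alg2 set"
  where "uq_comult q X = the_elem ((\<lambda>h. uq2_class q (free_lift const comult_gen h)) ` X)"

definition uq_counit :: "uq_gen free_alg set \<Rightarrow> complex"
  where "uq_counit X = the_elem (free_lift (\<lambda>c. c) counit_gen ` X)"

section \<open>Representations\<close>

definition End_alg :: "(complex, 'v) module \<Rightarrow> (complex, 'v \<Rightarrow> 'v) module"
  where "End_alg V =
    \<lparr>carrier = LinearCombinations.module_hom class_ring V V \<inter> extensional (carrier V),
     mult = compose (carrier V),
     one = (\<lambda>v\<in>carrier V. v),
     zero = (\<lambda>v\<in>carrier V. \<zero>\<^bsub>V\<^esub>),
     add = (\<lambda>f g. \<lambda>v\<in>carrier V. f v \<oplus>\<^bsub>V\<^esub> g v),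
     smult = (\<lambda>c f. \<lambda>v\<in>carrier V. c \<odot>\<^bsub>V\<^esub> f v)\<rparr>"

definition alg_hom :: "(complex, 'u) module \<Rightarrow> (complex, 'v) module \<Rightarrow> ('u \<Rightarrow> 'v) set"
  where "alg_hom A B = Ring.ring_hom A B \<inter> LinearCombinations.module_hom class_ring A B"

definition is_rep :: "(complex, 'u) module \<Rightarrow> (complex, 'v) module \<Rightarrow> ('u \<Rightarrow> 'v \<Rightarrow> 'v) \<Rightarrow> bool"
  where "is_rep U V \<pi> \<longleftrightarrow> \<pi> \<in> alg_hom U (End_alg V)"

definition subrep ::
    "(complex, 'u) module \<Rightarrow> (complex, 'v) module \<Rightarrow> ('u \<Rightarrow> 'v \<Rightarrow> 'v) \<Rightarrow> 'v set \<Rightarrow> bool"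
  where "subrep U V \<pi> W \<longleftrightarrow>
    VectorSpace.subspace class_ring W V \<and> (\<forall>h\<in>carrier U. \<forall>w\<in>W. \<pi> h w \<in> W)"

definition restrict_rep :: "('u \<Rightarrow> 'v \<Rightarrow> 'v) \<Rightarrow> 'v set \<Rightarrow> 'u \<Rightarrow> 'v \<Rightarrow> 'v"
  where "restrict_rep \<pi> W h = restrict (\<pi> h) W"

definition irreducible_rep ::
    "(complex, 'u) module \<Rightarrow> (complex, 'v) module \<Rightarrow> ('u \<Rightarrow> 'v \<Rightarrow> 'v) \<Rightarrow> bool"
  where "irreducible_rep U V \<pi> \<longleftrightarrow> is_rep U V \<pi> \<and> carrier V \<noteq> {\<zero>\<^bsub>V\<^esub>} \<and>
    (\<forall>W. subrep U V \<pi> W \<longrightarrow> W = {\<zero>\<^bsub>V\<^esub>} \<or> W = carrier V)"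

definition isomorphic_reps ::
    "(complex, 'u) module \<Rightarrow> (complex, 'v) module \<Rightarrow> ('u \<Rightarrow> 'v \<Rightarrow> 'v)
      \<Rightarrow> (complex, 'w) module \<Rightarrow> ('u \<Rightarrow> 'w \<Rightarrow> 'w) \<Rightarrow> bool"
  where "isomorphic_reps U V \<pi> W \<rho> \<longleftrightarrow>
    (\<exists>\<phi>. \<phi> \<in> LinearCombinations.module_hom class_ring V W \<and> bij_betw \<phi> (carrier V) (carrier W) \<and>
      (\<forall>h\<in>carrier U. \<forall>v\<in>carrier V. \<phi> (\<pi> h v) = \<rho> h (\<phi> v)))"

text \<open>The conjunct \<open>fin_dim\<close> is needed because \<open>dim\<close> is unspecified in infinite dimension.\<close>

definition one_dimensional :: "(complex, 'v) module \<Rightarrow> bool"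
  where "one_dimensional V \<longleftrightarrow>
    vectorspace class_ring V \<and> vectorspace.fin_dim class_ring V \<and> vectorspace.dim class_ring V = 1"

definition line :: "(complex, 'v) module \<Rightarrow> 'v \<Rightarrow> 'v set"
  where "line V v = (\<lambda>c. c \<odot>\<^bsub>V\<^esub> v) ` UNIV"

definition internal_direct_sum :: "(complex, 'v) module \<Rightarrow> 'i set \<Rightarrow> ('i \<Rightarrow> 'v set) \<Rightarrow> bool"
  where "internal_direct_sum V I W \<longleftrightarrow> (\<forall>i\<in>I. VectorSpace.subspace class_ring (W i) V) \<and>
    (\<forall>v\<in>carrier V. \<exists>!w. w \<in> (\<Pi>\<^sub>E i\<in>I. W i) \<and> finite {i\<in>I. w i \<noteq> \<zero>\<^bsub>V\<^esub>} \<and>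
      v = (\<Oplus>\<^bsub>V\<^esub>i\<in>{i\<in>I. w i \<noteq> \<zero>\<^bsub>V\<^esub>}. w i))"

definition qp_line :: "complex \<Rightarrow> nat \<Rightarrow> nat \<Rightarrow> qp_gen free_alg set set"
  where "qp_line q m n = line (qplane q) (qp_mono q m n)"

section \<open>Module algebra structures\<close>

text \<open>The Sweedler condition is imposed for every way of writing the comultiplication of an
  element as a finite sum of elementary tensors.\<close>

definition uq_module_algebra ::
    "complex \<Rightarrow> (complex, 'a) module \<Rightarrow> (uq_gen free_alg set \<Rightarrow> 'a \<Rightarrow> 'a) \<Rightarrow> bool"
  where "uq_module_algebra q A \<pi> \<longleftrightarrow> is_rep (Uq q) A \<pi> \<and>
    (\<forall>H\<in>carrier (Uq q). \<forall>(n::nat) h' h''.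
      uq_comult q H = uq2_class q (\<Sum>i<n. tens (h' i) (h'' i)) \<longrightarrow>
      (\<forall>a\<in>carrier A. \<forall>b\<in>carrier A. \<pi> H (a \<otimes>\<^bsub>A\<^esub> b) =
        (\<Oplus>\<^bsub>A\<^esub>i\<in>{..<n}. \<pi> (uq_class q (h' i)) a \<otimes>\<^bsub>A\<^esub> \<pi> (uq_class q (h'' i)) b))) \<and>
    (\<forall>H\<in>carrier (Uq q). \<pi> H \<one>\<^bsub>A\<^esub> = uq_counit H \<odot>\<^bsub>A\<^esub> \<one>\<^bsub>A\<^esub>)"

section \<open>The comultiplication and the counit are well defined\<close>

lemma genideal_class_ring: "ideal (Idl\<^bsub>class_ring\<^esub> S) (class_ring :: 'a::ring_1 ring)"
  by (rule ring.genideal_ideal[OF class_ring.ring_axioms]) simp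

lemma genideal_class_ring_closed:
  fixes S :: "'a::ring_1 set"
  defines "I \<equiv> Idl\<^bsub>class_ring\<^esub> S"
  shows "0 \<in> I" "a \<in> I \<Longrightarrow> b \<in> I \<Longrightarrow> a + b \<in> I" "a \<in> I \<Longrightarrow> b \<in> I \<Longrightarrow> a - b \<in> I"
    "a \<in> I \<Longrightarrow> r * a \<in> I" "a \<in> I \<Longrightarrow> a * r \<in> I" "s \<in> S \<Longrightarrow> s \<in> I"
proof -
  interpret ideal I "class_ring :: 'a ring" unfolding I_def by (rule genideal_class_ring)
  show "0 \<in> I" using zero_closed by simp
  show add: "a \<in> I \<Longrightarrow> b \<in> I \<Longrightarrow> a + b \<in> I" for a b using a_closed by simp
  show l: "a \<in> I \<Longrightarrow> r * a \<in> I" for a r using I_l_closed[of a r] by simp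
  show "a \<in> I \<Longrightarrow> a * r \<in> I" for a r using I_r_closed[of a r] by simp
  show "a - b \<in> I" if "a \<in> I" "b \<in> I"
    using add[OF that(1) l[OF that(2), of "-1"]] by simp
  show "s \<in> S \<Longrightarrow> s \<in> I"
    unfolding I_def using ring.genideal_self[OF class_ring.ring_axioms, of S] by auto
qed

lemma genideal_class_ring_least:
  fixes S :: "'a::ring_1 set"
  assumes "S \<subseteq> P" "0 \<in> P" "\<And>a b. a \<in> P \<Longrightarrow> b \<in> P \<Longrightarrow> a + b \<in> P"
    "\<And>a r. a \<in> P \<Longrightarrow> r * a \<in> P" "\<And>a r. a \<in> P \<Longrightarrow> a * r \<in> P"
  shows "Idl\<^bsub>class_ring\<^esub> S \<subseteq> P"
proof -
  have neg: "- a \<in> P" if "a \<in> P" for a using assms(4)[OF that, of "-1"] by simp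
  have "ideal P (class_ring :: 'a ring)"
  proof (rule idealI)
    show "ring (class_ring :: 'a ring)" by (rule class_ring.ring_axioms)
    show "subgroup P (add_monoid (class_ring :: 'a ring))"
    proof (rule group.subgroupI)
      show "group (add_monoid (class_ring :: 'a ring))"
        by (rule abelian_group.a_group[OF ring.is_abelian_group[OF class_ring.ring_axioms]])
      fix a assume a: "a \<in> P"
      have "\<ominus>\<^bsub>class_ring :: 'a ring\<^esub> a = - a"
        by (simp add: class_ring_simps)
      then have "inv\<^bsub>add_monoid (class_ring :: 'a ring)\<^esub> a = - a"
        by (simp only: a_inv_def)
      then show "inv\<^bsub>add_monoid (class_ring :: 'a ring)\<^esub> a \<in> P" using neg a by simp
    qed (use assms in auto)
  qed (use assms in auto)
  then show ?thesis using assms(1) unfolding genideal_def by blast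
qed

lemma rel_class_eq_iff: "rel_class S a = rel_class S b \<longleftrightarrow> a - b \<in> Idl\<^bsub>class_ring\<^esub> S"
proof -
  have "a \<ominus>\<^bsub>class_ring\<^esub> b = a - b"
    by (simp add: class_ring_simps)
  then show ?thesis
  unfolding rel_class_def
  using ring.quotient_eq_iff_same_a_r_cos[OF class_ring.ring_axioms genideal_class_ring, of a b S]
  by simp
qed

lemma mem_rel_class: "h \<in> rel_class S a \<longleftrightarrow> h - a \<in> Idl\<^bsub>class_ring\<^esub> S"
  unfolding rel_class_def a_r_coset_def' by (auto intro!: bexI[of _ "h - a"])


lemma poly_mapping_eq_sum_single:
  "(\<Sum>w\<in>Poly_Mapping.keys h. Poly_Mapping.single w (Poly_Mapping.lookup h w)) = h"
  by (rule poly_mapping_eqI)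
    (simp add: lookup_sum lookup_single when_def not_in_keys_iff_lookup_eq_zero)

lemma free_lift_superset:
  assumes "finite A" "Poly_Mapping.keys h \<subseteq> A" "s 0 = 0"
  shows "free_lift s \<phi> h = (\<Sum>w\<in>A. s (Poly_Mapping.lookup h w) * prod_list (map \<phi> w))"
  unfolding free_lift_def using assms
  by (intro sum.mono_neutral_left) (auto simp: not_in_keys_iff_lookup_eq_zero)

context
  fixes s :: "complex \<Rightarrow> 'b::ring_1" and \<phi> :: "'g \<Rightarrow> 'b"
  assumes s_add: "\<And>c d. s (c + d) = s c + s d"
    and s_mult: "\<And>c d. s (c * d) = s c * s d"
    and s_one: "s 1 = 1"
    and s_central: "\<And>c x. x * s c = s c * x"
begin

lemma s_zero: "s 0 = 0"
  using s_add[of 0 0] by simp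

lemma free_lift_add: "free_lift s \<phi> (a + b) = free_lift s \<phi> a + free_lift s \<phi> b"
proof -
  let ?A = "Poly_Mapping.keys a \<union> Poly_Mapping.keys b"
  have "free_lift s \<phi> (a + b)
      = (\<Sum>w\<in>?A. s (Poly_Mapping.lookup (a + b) w) * prod_list (map \<phi> w))"
    by (rule free_lift_superset) (auto simp: s_zero dest: subsetD[OF Poly_Mapping.keys_add])
  also have "\<dots> = free_lift s \<phi> a + free_lift s \<phi> b"
    by (subst (1 2) free_lift_superset[of ?A])
      (auto simp: s_zero s_add lookup_add distrib_right sum.distrib)
  finally show ?thesis .
qed

lemma free_lift_single: "free_lift s \<phi> (Poly_Mapping.single w c) = s c * prod_list (map \<phi> w)"
  by (subst free_lift_superset[of "{w}"]) (auto simp: s_zero)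

lemma free_lift_zero: "free_lift s \<phi> 0 = 0"
  by (simp add: free_lift_def)

lemma free_lift_sum: "free_lift s \<phi> (\<Sum>i\<in>A. f i) = (\<Sum>i\<in>A. free_lift s \<phi> (f i))"
  by (induction A rule: infinite_finite_induct) (auto simp: free_lift_zero free_lift_add)

lemma free_lift_minus: "free_lift s \<phi> (a - b) = free_lift s \<phi> a - free_lift s \<phi> b"
  using free_lift_add[of "a - b" b] by simp

lemma free_lift_one: "free_lift s \<phi> 1 = 1"
  by (subst single_one[symmetric]) (simp add: free_lift_single s_one zero_list_def)

lemma free_lift_gen: "free_lift s \<phi> (gen g) = \<phi> g"
  by (simp add: gen_def free_lift_single s_one)

lemma free_lift_const: "free_lift s \<phi> (const c) = s c"
  by (simp add: free_lift_single zero_list_def)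

lemma free_lift_mult: "free_lift s \<phi> (a * b) = free_lift s \<phi> a * free_lift s \<phi> b"
proof -
  have single: "free_lift s \<phi> (Poly_Mapping.single u c * Poly_Mapping.single v d)
      = free_lift s \<phi> (Poly_Mapping.single u c) * free_lift s \<phi> (Poly_Mapping.single v d)"
    for u v c d
  proof -
    have "s c * s d * (prod_list (map \<phi> u) * prod_list (map \<phi> v))
        = s c * (s d * prod_list (map \<phi> u)) * prod_list (map \<phi> v)"
      by (simp add: mult.assoc)
    also have "s d * prod_list (map \<phi> u) = prod_list (map \<phi> u) * s d"
      by (simp add: s_central)
    finally show ?thesis
      by (simp add: mult_single free_lift_single s_mult plus_list_def mult.assoc)
  qed
  let ?S = "\<lambda>h. \<Sum>w\<in>Poly_Mapping.keys h. Poly_Mapping.single w (Poly_Mapping.lookup h w)"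
  have "free_lift s \<phi> (?S a * ?S b) = free_lift s \<phi> (?S a) * free_lift s \<phi> (?S b)"
    by (simp only: sum_product free_lift_sum single)
  then show ?thesis by (simp only: poly_mapping_eq_sum_single)
qed

lemma free_lift_genideal:
  assumes "a \<in> Idl\<^bsub>class_ring\<^esub> S" and "\<And>r. r \<in> S \<Longrightarrow> free_lift s \<phi> r \<in> Idl\<^bsub>class_ring\<^esub> T"
  shows "free_lift s \<phi> a \<in> Idl\<^bsub>class_ring\<^esub> T"
proof -
  have "Idl\<^bsub>class_ring\<^esub> S \<subseteq> {a. free_lift s \<phi> a \<in> Idl\<^bsub>class_ring\<^esub> T}"
    by (rule genideal_class_ring_least)
      (auto simp: assms(2) free_lift_zero free_lift_add free_lift_mult
        intro: genideal_class_ring_closed)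
  then show ?thesis using assms(1) by auto
qed

end

lemma tens_superset:
  assumes "finite A" "Poly_Mapping.keys a \<subseteq> A" "finite B" "Poly_Mapping.keys b \<subseteq> B"
  shows "tens a b = (\<Sum>u\<in>A. \<Sum>v\<in>B.
    Poly_Mapping.single (u, v) (Poly_Mapping.lookup a u * Poly_Mapping.lookup b v))"
proof -
  have "tens a b = (\<Sum>u\<in>Poly_Mapping.keys a. \<Sum>v\<in>B.
    Poly_Mapping.single (u, v) (Poly_Mapping.lookup a u * Poly_Mapping.lookup b v))"
    unfolding tens_def using assms
    by (intro sum.cong[OF refl] sum.mono_neutral_left) (auto simp: not_in_keys_iff_lookup_eq_zero)
  also have "\<dots> = (\<Sum>u\<in>A. \<Sum>v\<in>B.
    Poly_Mapping.single (u, v) (Poly_Mapping.lookup a u * Poly_Mapping.lookup b v))"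
    using assms
    by (intro sum.mono_neutral_left) (auto simp: not_in_keys_iff_lookup_eq_zero)
  finally show ?thesis .
qed

lemma lookup_tens:
  "Poly_Mapping.lookup (tens a b) (u, v) = Poly_Mapping.lookup a u * Poly_Mapping.lookup b v"
proof -
  let ?A = "insert u (Poly_Mapping.keys a)" and ?B = "insert v (Poly_Mapping.keys b)"
  have "Poly_Mapping.lookup (tens a b) (u, v) = (\<Sum>u'\<in>?A. \<Sum>v'\<in>?B.
      if u' = u then if v' = v then Poly_Mapping.lookup a u' * Poly_Mapping.lookup b v' else 0 else 0)"
    by (subst tens_superset[of ?A _ ?B])
      (auto simp: lookup_sum lookup_single when_def intro!: sum.cong)
  also have "\<dots> = (\<Sum>u'\<in>?A. if u' = u then Poly_Mapping.lookup a u' * Poly_Mapping.lookup b v else 0)"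
    by (intro sum.cong refl) (simp add: sum.delta)
  also have "\<dots> = Poly_Mapping.lookup a u * Poly_Mapping.lookup b v"
    by (simp add: sum.delta)
  finally show ?thesis .
qed

lemma tens_add_left: "tens (a + a') b = tens a b + tens a' b"
  and tens_add_right: "tens a (b + b') = tens a b + tens a b'"
  and tens_diff_left: "tens (a - a') b = tens a b - tens a' b"
  and tens_diff_right: "tens a (b - b') = tens a b - tens a b'"
  and tens_zero_left: "tens 0 b = 0"
  and tens_zero_right: "tens a 0 = 0"
  by (rule poly_mapping_eqI; clarsimp simp: lookup_tens lookup_add lookup_minus algebra_simps)+

lemma tens_single:
  "tens (Poly_Mapping.single u c) (Poly_Mapping.single v d) = Poly_Mapping.single (u, v) (c * d)"
  by (rule poly_mapping_eqI) (clarsimp simp: lookup_tens lookup_single when_def)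

lemma tens_sum_left: "tens (\<Sum>i\<in>A. f i) b = (\<Sum>i\<in>A. tens (f i) b)"
  by (induction A rule: infinite_finite_induct) (auto simp: tens_zero_left tens_add_left)

lemma tens_sum_right: "tens a (\<Sum>i\<in>A. f i) = (\<Sum>i\<in>A. tens a (f i))"
  by (induction A rule: infinite_finite_induct) (auto simp: tens_zero_right tens_add_right)

lemma tens_one: "tens 1 1 = 1"
  by (simp flip: single_one add: tens_single zero_prod_def)

lemma tens_mult: "tens a b * tens c d = tens (a * c) (b * d)"
proof -
  let ?S = "\<lambda>h. \<Sum>w\<in>Poly_Mapping.keys h. Poly_Mapping.single w (Poly_Mapping.lookup h w)"
  have "tens (?S a) (?S b) * tens (?S c) (?S d) = tens (?S a * ?S c) (?S b * ?S d)"
    by (simp only: tens_sum_left tens_sum_right sum_product mult_single tens_single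
        sum.swap[of _ "Poly_Mapping.keys b" "Poly_Mapping.keys c"] plus_prod_def)
      (simp add: mult_ac)
  then show ?thesis by (simp only: poly_mapping_eq_sum_single)
qed

lemma const_central:
  fixes x :: "'m::monoid_add \<Rightarrow>\<^sub>0 complex"
  shows "x * const c = const c * x"
proof -
  let ?S = "\<Sum>w\<in>Poly_Mapping.keys x. Poly_Mapping.single w (Poly_Mapping.lookup x w)"
  have "?S * const c = const c * ?S"
    by (simp only: sum_distrib_left sum_distrib_right mult_single) (simp add: mult_ac)
  then show ?thesis by (simp only: poly_mapping_eq_sum_single)
qed


lemma const_tens_left: "const c * tens a b = tens (const c * a) b"
  and const_tens_right: "const c * tens a b = tens a (const c * b)"
proof -
  have "const c = tens (const c) (1 :: 'a free_alg)" "const c = tens (1 :: 'a free_alg) (const c)"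
    by (simp_all add: tens_single zero_prod_def flip: single_one)
  then show "const c * tens a b = tens (const c * a) b" "const c * tens a b = tens a (const c * b)"
    by (metis mult_1 tens_mult)+
qed

lemma tens_genideal_left: "r \<in> Idl\<^bsub>class_ring\<^esub> (uq_rels q) \<Longrightarrow> tens r a \<in> Idl\<^bsub>class_ring\<^esub> (uq2_rels q)"
proof -
  have "Idl\<^bsub>class_ring\<^esub> (uq_rels q) \<subseteq> {r. tens r 1 \<in> Idl\<^bsub>class_ring\<^esub> (uq2_rels q)}"
  proof (rule genideal_class_ring_least)
    fix r s assume "r \<in> {r. tens r 1 \<in> Idl\<^bsub>class_ring\<^esub> (uq2_rels q)}"
    then have "tens s 1 * tens r 1 \<in> Idl\<^bsub>class_ring\<^esub> (uq2_rels q)" "tens r 1 * tens s 1 \<in> Idl\<^bsub>class_ring\<^esub> (uq2_rels q)"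
      by (auto intro: genideal_class_ring_closed)
    then show "s * r \<in> {r. tens r 1 \<in> Idl\<^bsub>class_ring\<^esub> (uq2_rels q)}" "r * s \<in> {r. tens r 1 \<in> Idl\<^bsub>class_ring\<^esub> (uq2_rels q)}"
      by (simp_all add: tens_mult)
  qed (auto simp: tens_zero_left tens_add_left uq2_rels_def intro: genideal_class_ring_closed)
  moreover assume "r \<in> Idl\<^bsub>class_ring\<^esub> (uq_rels q)"
  ultimately have "tens r 1 * tens 1 a \<in> Idl\<^bsub>class_ring\<^esub> (uq2_rels q)" by (auto intro: genideal_class_ring_closed)
  then show ?thesis by (simp add: tens_mult)
qed

lemma tens_genideal_right: "r \<in> Idl\<^bsub>class_ring\<^esub> (uq_rels q) \<Longrightarrow> tens a r \<in> Idl\<^bsub>class_ring\<^esub> (uq2_rels q)"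
proof -
  have "Idl\<^bsub>class_ring\<^esub> (uq_rels q) \<subseteq> {r. tens 1 r \<in> Idl\<^bsub>class_ring\<^esub> (uq2_rels q)}"
  proof (rule genideal_class_ring_least)
    fix r s assume "r \<in> {r. tens 1 r \<in> Idl\<^bsub>class_ring\<^esub> (uq2_rels q)}"
    then have "tens 1 s * tens 1 r \<in> Idl\<^bsub>class_ring\<^esub> (uq2_rels q)" "tens 1 r * tens 1 s \<in> Idl\<^bsub>class_ring\<^esub> (uq2_rels q)"
      by (auto intro: genideal_class_ring_closed)
    then show "s * r \<in> {r. tens 1 r \<in> Idl\<^bsub>class_ring\<^esub> (uq2_rels q)}" "r * s \<in> {r. tens 1 r \<in> Idl\<^bsub>class_ring\<^esub> (uq2_rels q)}"
      by (simp_all add: tens_mult)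
  qed (auto simp: tens_zero_right tens_add_right uq2_rels_def intro: genideal_class_ring_closed)
  moreover assume "r \<in> Idl\<^bsub>class_ring\<^esub> (uq_rels q)"
  ultimately have "tens 1 r * tens a 1 \<in> Idl\<^bsub>class_ring\<^esub> (uq2_rels q)" by (auto intro: genideal_class_ring_closed)
  then show ?thesis by (simp add: tens_mult)
qed

lemma const_mult: "const (c * d) = (const c * const d :: 'm::monoid_add \<Rightarrow>\<^sub>0 complex)"
  by (simp add: mult_single)

lemma comult_diff: "free_lift const comult_gen (a - b) = free_lift const comult_gen a - free_lift const comult_gen b"
  by (rule free_lift_minus[OF single_add const_mult single_one const_central])

lemma comult_mult: "free_lift const comult_gen (a * b) = free_lift const comult_gen a * free_lift const comult_gen b"
  by (rule free_lift_mult[OF single_add const_mult single_one const_central])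

lemma comult_one: "free_lift const comult_gen 1 = 1"
  by (rule free_lift_one[OF single_add const_mult single_one const_central])

lemma comult_gen_eq: "free_lift const comult_gen (gen g) = comult_gen g"
  by (rule free_lift_gen[OF single_add const_mult single_one const_central])

lemma comult_const: "free_lift const comult_gen (const c) = const c"
  by (rule free_lift_const[OF single_add const_mult single_one const_central])

lemmas comult_hom = comult_diff comult_mult comult_one comult_gen_eq comult_const

lemma comult_rels:
  assumes "q \<noteq> 0" "r \<in> uq_rels q"
  shows "free_lift const comult_gen r \<in> Idl\<^bsub>class_ring\<^esub> (uq2_rels q)"
proof -
  define k k' e f :: "uq_gen free_alg"
    where defs: "k = gen Gen_k" "k' = gen Gen_kinv" "e = gen Gen_e" "f = gen Gen_f"
  define C D E :: "uq_gen free_alg"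
    where CD: "C = const (q^2)" "D = const (inverse (q^2))" "E = const (1 / (q - inverse q))"
  let ?R1 = "k' * k - 1" and ?R2 = "k * k' - 1" and ?R3 = "k * e - C * e * k"
    and ?R4 = "k * f - D * f * k" and ?R5 = "e * f - f * e - E * (k - k')"
  have rels: "uq_rels q = {?R1, ?R2, ?R3, ?R4, ?R5}"
    unfolding uq_rels_def Let_def defs CD ..
  have R: "?R1 \<in> Idl\<^bsub>class_ring\<^esub> (uq_rels q)" "?R2 \<in> Idl\<^bsub>class_ring\<^esub> (uq_rels q)" "?R3 \<in> Idl\<^bsub>class_ring\<^esub> (uq_rels q)" "?R4 \<in> Idl\<^bsub>class_ring\<^esub> (uq_rels q)" "?R5 \<in> Idl\<^bsub>class_ring\<^esub> (uq_rels q)"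
    by (rule genideal_class_ring_closed; simp add: rels)+
  note T = R[THEN tens_genideal_left] R[THEN tens_genideal_right]
  let ?\<Delta> = "free_lift const comult_gen"
  have \<Delta>: "?\<Delta> k = tens k k" "?\<Delta> k' = tens k' k'" "?\<Delta> e = tens 1 e + tens e k"
    "?\<Delta> f = tens f 1 + tens k' f"
    by (simp_all add: defs comult_hom)
  have \<Delta>C: "?\<Delta> C = const (q^2)" "?\<Delta> D = const (inverse (q^2))" "?\<Delta> E = const (1 / (q - inverse q))"
    by (simp_all add: CD comult_hom)
  note tens_bilin = tens_mult tens_add_left tens_add_right tens_diff_left tens_diff_right
  have CDone: "C * D = 1" "D * C = 1"
    using assms(1) by (simp_all add: CD mult_single)
  have CDc: "x * C = C * x" "x * D = D * x" "x * E = E * x" for x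
    by (simp_all add: CD const_central)
  consider "r = ?R1" | "r = ?R2" | "r = ?R3" | "r = ?R4" | "r = ?R5"
    using assms(2) unfolding rels by auto
  then show ?thesis
  proof cases
    case 1
    have "?\<Delta> r = tens ?R1 (k' * k) + tens 1 ?R1"
      by (simp add: 1 comult_hom \<Delta> tens_bilin tens_one)
    then show ?thesis by (auto intro: genideal_class_ring_closed T)
  next
    case 2
    have "?\<Delta> r = tens ?R2 (k * k') + tens 1 ?R2"
      by (simp add: 2 comult_hom \<Delta> tens_bilin tens_one)
    then show ?thesis by (auto intro: genideal_class_ring_closed T)
  next
    case 3
    have "?\<Delta> r = tens k (k * e) + tens (k * e) (k * k)
        - (const (q^2) * tens k (e * k) + const (q^2) * tens (e * k) (k * k))"
      by (simp add: 3 comult_hom \<Delta> \<Delta>C tens_bilin distrib_left distrib_right mult.assoc)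
    also have "\<dots> = tens k ?R3 + tens ?R3 (k * k)"
      unfolding const_tens_right[of _ k] const_tens_left[of _ "e * k"]
      by (simp add: tens_bilin mult.assoc flip: CD)
    finally show ?thesis by (auto intro: genideal_class_ring_closed T)
  next
    case 4
    have "?\<Delta> r = tens (k * f) k + tens (k * k') (k * f)
        - (const (inverse (q^2)) * tens (f * k) k + const (inverse (q^2)) * tens (k' * k) (f * k))"
      by (simp add: 4 comult_hom \<Delta> \<Delta>C tens_bilin distrib_left distrib_right mult.assoc)
    also have "\<dots> = tens ?R4 k + tens ?R2 (k * f) + tens 1 ?R4 - tens ?R1 (D * f * k)"
      unfolding const_tens_left[of _ "f * k"] const_tens_right[of _ "k' * k"]
      by (simp add: tens_bilin mult.assoc flip: CD)
    finally show ?thesis by (auto intro: genideal_class_ring_closed T)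
  next
    case 5
    let ?E2 = "const (1 / (q - inverse q)) :: uq_gen free_alg2"
    have ek: "e * k' - C * (k' * e) \<in> Idl\<^bsub>class_ring\<^esub> (uq_rels q)"
    proof -
      have "k' * (C * x) = C * (k' * x)" for x
        by (metis CDc(1) mult.assoc)
      then have "e * k' - C * (k' * e) = C * k' * e * ?R2 + k' * ?R3 * k' - ?R1 * e * k'"
        by (simp add: left_diff_distrib right_diff_distrib mult.assoc)
      moreover have "C * k' * e * ?R2 + k' * ?R3 * k' - ?R1 * e * k' \<in> Idl\<^bsub>class_ring\<^esub> (uq_rels q)"
        by (intro genideal_class_ring_closed(2-5) R)
      ultimately show ?thesis by simp
    qed
    have "?\<Delta> r = tens k' (e * f - f * e) + tens (e * f - f * e) k + (tens (e * k') (k * f)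
        - tens (k' * e) (f * k)) - ?E2 * (tens k k - tens k' k')"
      by (simp add: 5 comult_hom \<Delta> \<Delta>C tens_bilin distrib_left distrib_right mult.assoc)
    also have "?E2 * (tens k k - tens k' k')
        = ?E2 * tens k' (k - k') + ?E2 * tens (k - k') k"
      by (simp add: tens_bilin right_diff_distrib flip: distrib_left)
    also have "\<dots> = tens k' (E * (k - k')) + tens (E * (k - k')) k"
      unfolding const_tens_right[of _ k'] const_tens_left[of _ "k - k'"] CD ..
    also have "tens (e * k') (k * f) - tens (k' * e) (f * k)
       = tens (e * k') ?R4 + tens (e * k' - C * (k' * e)) (D * f * k)"
    proof -
      have "tens (C * (k' * e)) (D * f * k) = const (q^2) * tens (k' * e) (D * (f * k))"
        by (simp only: const_tens_left CD mult.assoc)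
      also have "\<dots> = const (q^2) * (const (inverse (q^2)) * tens (k' * e) (f * k))"
        by (simp only: const_tens_right CD)
      also have "\<dots> = tens (k' * e) (f * k)"
        using assms(1) by (simp add: mult_single flip: mult.assoc)
      finally show ?thesis by (simp add: tens_bilin)
    qed
    finally have "?\<Delta> r = tens k' ?R5 + tens ?R5 k + tens (e * k') ?R4
        + tens (e * k' - C * (k' * e)) (D * f * k)"
      by (simp add: tens_bilin)
    moreover have "tens k' ?R5 + tens ?R5 k + tens (e * k') ?R4
        + tens (e * k' - C * (k' * e)) (D * f * k) \<in> Idl\<^bsub>class_ring\<^esub> (uq2_rels q)"
      by (intro genideal_class_ring_closed(2) T tens_genideal_left[OF ek])
    ultimately show ?thesis by simp
  qed
qed

lemma uq_comult_class:
  assumes "q \<noteq> 0"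
  shows "uq_comult q (uq_class q h) = uq2_class q (free_lift const comult_gen h)"
  unfolding uq_comult_def
proof (rule the_elem_image_unique)
  have "h \<in> uq_class q h"
    unfolding uq_class_def mem_rel_class by (simp add: genideal_class_ring_closed)
  then show "uq_class q h \<noteq> {}" by blast
next
  fix h' assume h': "h' \<in> uq_class q h"
  have "free_lift const comult_gen (h' - h) \<in> Idl\<^bsub>class_ring\<^esub> (uq2_rels q)"
  proof (rule free_lift_genideal[where S = "uq_rels q"])
    show "h' - h \<in> Idl\<^bsub>class_ring\<^esub> (uq_rels q)" using h' unfolding uq_class_def mem_rel_class .
    show "free_lift const comult_gen r \<in> Idl\<^bsub>class_ring\<^esub> (uq2_rels q)" if "r \<in> uq_rels q" for r
      by (rule comult_rels[OF assms that])
  qed (rule single_add const_mult single_one const_central)+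
  then show "uq2_class q (free_lift const comult_gen h') = uq2_class q (free_lift const comult_gen h)"
    unfolding uq2_class_def rel_class_eq_iff comult_hom .
qed

lemma counit_diff: "free_lift (\<lambda>c. c) counit_gen (a - b) = free_lift (\<lambda>c. c) counit_gen a - free_lift (\<lambda>c. c) counit_gen b"
  by (intro free_lift_minus) (rule refl mult.commute)+

lemma counit_mult: "free_lift (\<lambda>c. c) counit_gen (a * b) = free_lift (\<lambda>c. c) counit_gen a * free_lift (\<lambda>c. c) counit_gen b"
  by (intro free_lift_mult) (rule refl mult.commute)+

lemma counit_one: "free_lift (\<lambda>c. c) counit_gen 1 = 1"
  by (intro free_lift_one) (rule refl mult.commute)+

lemma counit_gen_eq: "free_lift (\<lambda>c. c) counit_gen (gen g) = counit_gen g"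
  by (intro free_lift_gen) (rule refl mult.commute)+

lemma counit_const: "free_lift (\<lambda>c. c) counit_gen (const c) = c"
  using free_lift_const[where s = "\<lambda>c. c" and \<phi> = counit_gen and c = c]
  by (simp add: mult.commute)

lemma uq_counit_class: "uq_counit (uq_class q h) = free_lift (\<lambda>c. c) counit_gen h"
  unfolding uq_counit_def
proof (rule the_elem_image_unique)
  have "h \<in> uq_class q h"
    unfolding uq_class_def mem_rel_class by (simp add: genideal_class_ring_closed)
  then show "uq_class q h \<noteq> {}" by blast
next
  fix h' assume h': "h' \<in> uq_class q h"
  have "free_lift (\<lambda>c. c) counit_gen (h' - h) \<in> Idl\<^bsub>class_ring\<^esub> {}"
  proof (rule free_lift_genideal[where S = "uq_rels q"])
    show "h' - h \<in> Idl\<^bsub>class_ring\<^esub> (uq_rels q)" using h' unfolding uq_class_def mem_rel_class .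
    show "free_lift (\<lambda>c. c) counit_gen r \<in> Idl\<^bsub>class_ring\<^esub> {}" if "r \<in> uq_rels q" for r
    proof -
      have "free_lift (\<lambda>c. c) counit_gen r = 0"
        using that by (auto simp: uq_rels_def Let_def counit_diff counit_mult counit_one
            counit_gen_eq counit_const)
      then show ?thesis by (simp add: genideal_class_ring_closed)
    qed
  qed (rule refl mult.commute)+
  moreover have "Idl\<^bsub>class_ring\<^esub> {} \<subseteq> {0::complex}"
    by (rule genideal_class_ring_least) auto
  ultimately show "free_lift (\<lambda>c. c) counit_gen h' = free_lift (\<lambda>c. c) counit_gen h"
    unfolding counit_diff by auto
qed

end

theory Submission
  imports Defs
begin

text \<open>There are two independent points.

  The monomials form a basis of the quantum plane. They span, because the relation \<open>y x = q x y\<close>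
  sorts every word, at the price of a factor \<open>q\<close> for each pair of an \<open>x\<close> and an earlier \<open>y\<close>
  (\<open>qp_normal_form_word\<close>). They are linearly independent, because this factor, the number of
  such pairs being determined by the word, defines coefficient functionals on the free algebra that
  vanish on the ideal of the relation (\<open>qp_coeff_ideal\<close>). Together this is the decomposition into
  lines (\<open>qplane_direct_sum\<close>).

  Every monomial is a common eigenvector of the quantum group. The formulas for the
  comultiplication of \<open>k\<close>, \<open>e\<close>, \<open>f\<close> show that the weight vectors killed by \<open>e\<close> and \<open>f\<close> are closed
  under products, with multiplicative weights (\<open>extremal_vector_mult\<close>). The generators \<open>x\<close>, \<open>y\<close> are
  such vectors of weights \<open>\<alpha>\<close>, \<open>\<beta>\<close>, so \<open>x\<^sup>m y\<^sup>n\<close> is one of weight \<open>\<alpha>\<^sup>m \<beta>\<^sup>n\<close>. On such a vector every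
  element of the quantum group acts by a scalar that is determined by the weight
  (\<open>extremal_vector_action\<close>). So each line is a subrepresentation, irreducible for dimension reasons,
  and two lines are isomorphic if and only if all elements act on them by the same scalars
  (\<open>isomorphic_lines_iff\<close>). If the weights agree, the scalars do; conversely the weight is the scalar
  of \<open>k\<close>.\<close>

section \<open>Algebras given by generators and relations as vector spaces\<close>

lemma carrier_quot_alg: "carrier (quot_alg S) = range (rel_class S)"
  unfolding quot_alg_def rel_class_def
  by (auto simp: ring.defs FactRing_def A_RCOSETS_def' )

lemma zero_quot_alg: "\<zero>\<^bsub>quot_alg S\<^esub> = rel_class S 0"
proof -
  have "rel_class S 0 = Idl\<^bsub>class_ring\<^esub> S"
    by (auto simp: mem_rel_class)
  then show ?thesis by (simp add: quot_alg_def ring.defs FactRing_def)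
qed

lemma one_quot_alg: "\<one>\<^bsub>quot_alg S\<^esub> = rel_class S 1"
  by (simp add: quot_alg_def ring.defs FactRing_def rel_class_def)

lemma add_quot_alg: "rel_class S a \<oplus>\<^bsub>quot_alg S\<^esub> rel_class S b = rel_class S (a + b)"
  using abelian_subgroup.a_rcos_sum[OF abelian_subgroupI3[OF ideal.axioms(1)[OF genideal_class_ring]
      ring.is_abelian_group[OF class_ring.ring_axioms]], of a b S]
  by (simp add: quot_alg_def ring.defs FactRing_def rel_class_def)

lemma mult_quot_alg: "rel_class S a \<otimes>\<^bsub>quot_alg S\<^esub> rel_class S b = rel_class S (a * b)"
  using ideal.rcoset_mult_add[OF genideal_class_ring, of a b S]
  by (simp add: quot_alg_def ring.defs FactRing_def rel_class_def)

text \<open>Scalar multiplication is a union over all representatives. Two representatives differ by an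
  element of the ideal, which stays in the ideal after multiplication by a scalar, so all members of
  the union are the same coset.\<close>
lemma smult_quot_alg: "c \<odot>\<^bsub>quot_alg S\<^esub> rel_class S a = rel_class S (const c * a)"
proof -
  have eq: "rel_class S (const c * b) = rel_class S (const c * a)" if "b \<in> rel_class S a" for b
    using that genideal_class_ring_closed(4)[of "b - a" S "const c"]
    by (simp add: mem_rel_class rel_class_eq_iff right_diff_distrib)
  have "a \<in> rel_class S a" by (simp add: mem_rel_class genideal_class_ring_closed)
  then have "(\<Union>b\<in>rel_class S a. rel_class S (const c * b)) = rel_class S (const c * a)"
    using eq by blast
  then show ?thesis by (simp add: quot_alg_def ring.defs module.defs)
qed

lemmas quot_alg_simps = zero_quot_alg one_quot_alg add_quot_alg mult_quot_alg smult_quot_alg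

lemma vectorspace_quot_alg: "vectorspace class_ring (quot_alg S)"
proof -
  let ?A = "quot_alg S"
  have "abelian_group ?A"
  proof (rule abelian_groupI)
    fix x assume "x \<in> carrier ?A"
    then obtain a where a: "x = rel_class S a" by (auto simp: carrier_quot_alg)
    show "\<exists>y\<in>carrier ?A. y \<oplus>\<^bsub>?A\<^esub> x = \<zero>\<^bsub>?A\<^esub>"
      by (rule bexI[of _ "rel_class S (- a)"]) (auto simp: a carrier_quot_alg quot_alg_simps)
  qed (auto simp: carrier_quot_alg quot_alg_simps add_ac)
  then have "Module.module class_ring ?A"
    by (intro moduleI class_cring.cring_axioms)
      (auto simp: carrier_quot_alg quot_alg_simps single_add distrib_left distrib_right const_mult mult.assoc)
  then show ?thesis by (intro vectorspace.intro class_field)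
qed

lemma pow_quot_alg: "rel_class S a [^]\<^bsub>quot_alg S\<^esub> (n::nat) = rel_class S (a ^ n)"
  by (induction n) (simp_all add: quot_alg_simps power_Suc2 del: power_Suc)

lemma finsum_quot_alg:
  "(\<Oplus>\<^bsub>quot_alg S\<^esub>i\<in>A. rel_class S (f i)) = rel_class S (\<Sum>i\<in>A. f i)"
proof -
  interpret vectorspace class_ring "quot_alg S" by (rule vectorspace_quot_alg)
  show ?thesis
    by (induction A rule: infinite_finite_induct) (auto simp: quot_alg_simps carrier_quot_alg)
qed

lemma gen_mult_single: "gen g * Poly_Mapping.single w c = Poly_Mapping.single (g # w) c"
  by (simp add: gen_def mult_single plus_list_def)

section \<open>Lines in a representation\<close>

context
  fixes V :: "(complex, 'v) module"
  assumes V: "vectorspace class_ring V"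
begin

interpretation V: vectorspace class_ring V by (rule V)

lemma vec_smult_smult: "v \<in> carrier V \<Longrightarrow> c \<odot>\<^bsub>V\<^esub> (d \<odot>\<^bsub>V\<^esub> v) = (c * d) \<odot>\<^bsub>V\<^esub> v"
  using V.smult_assoc1[of c d v] by simp

lemma vec_smult_add: "v \<in> carrier V \<Longrightarrow> c \<odot>\<^bsub>V\<^esub> v \<oplus>\<^bsub>V\<^esub> d \<odot>\<^bsub>V\<^esub> v = (c + d) \<odot>\<^bsub>V\<^esub> v"
  using V.smult_l_distr[of c d v] by simp

lemma vec_smult_one: "v \<in> carrier V \<Longrightarrow> 1 \<odot>\<^bsub>V\<^esub> v = v"
  using V.smult_one[of v] by simp

lemma vec_zero_smult: "v \<in> carrier V \<Longrightarrow> 0 \<odot>\<^bsub>V\<^esub> v = \<zero>\<^bsub>V\<^esub>"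
  using V.lmult_0[of v] by simp

lemma vec_smult_zero: "c \<odot>\<^bsub>V\<^esub> \<zero>\<^bsub>V\<^esub> = \<zero>\<^bsub>V\<^esub>"
  using V.rmult_0[of c] by simp

lemma vec_smult_eq_iff:
  assumes "v \<in> carrier V" "v \<noteq> \<zero>\<^bsub>V\<^esub>"
  shows "c \<odot>\<^bsub>V\<^esub> v = d \<odot>\<^bsub>V\<^esub> v \<longleftrightarrow> c = d"
proof
  assume eq: "c \<odot>\<^bsub>V\<^esub> v = d \<odot>\<^bsub>V\<^esub> v"
  have "(c - d) \<odot>\<^bsub>V\<^esub> v = c \<odot>\<^bsub>V\<^esub> v \<oplus>\<^bsub>V\<^esub> (- d) \<odot>\<^bsub>V\<^esub> v"
    using assms by (simp add: vec_smult_add)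
  also have "\<dots> = d \<odot>\<^bsub>V\<^esub> v \<oplus>\<^bsub>V\<^esub> (- d) \<odot>\<^bsub>V\<^esub> v" by (simp only: eq)
  also have "\<dots> = \<zero>\<^bsub>V\<^esub>" using assms by (simp add: vec_smult_add vec_zero_smult)
  finally have z: "(c - d) \<odot>\<^bsub>V\<^esub> v = \<zero>\<^bsub>V\<^esub>" .
  show "c = d"
  proof (rule ccontr)
    assume "c \<noteq> d"
    then have "v = inverse (c - d) \<odot>\<^bsub>V\<^esub> ((c - d) \<odot>\<^bsub>V\<^esub> v)"
      using assms by (simp add: vec_smult_smult vec_smult_one)
    then show False using assms by (simp add: z vec_smult_zero)
  qed
qed simp

lemma subspace_line:
  assumes "v \<in> carrier V"
  shows "VectorSpace.subspace class_ring (line V v) V"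
proof (intro VectorSpace.subspace.intro submodule.intro V V.module_axioms)
  show "line V v \<subseteq> carrier V" using assms by (auto simp: line_def)
  show "\<zero>\<^bsub>V\<^esub> \<in> line V v" unfolding line_def
    by (rule image_eqI[of _ _ 0]) (simp_all add: vec_zero_smult assms)
  show "a \<oplus>\<^bsub>V\<^esub> b \<in> line V v" if "a \<in> line V v" "b \<in> line V v" for a b
    using that assms by (auto simp: line_def vec_smult_add)
  show "c \<odot>\<^bsub>V\<^esub> a \<in> line V v" if "c \<in> carrier class_ring" "a \<in> line V v" for a c
    using that assms by (auto simp: line_def vec_smult_smult)
qed

lemma self_in_line: "v \<in> carrier V \<Longrightarrow> v \<in> line V v"
  unfolding line_def by (rule image_eqI[of _ _ 1]) (simp_all add: vec_smult_one)

text \<open>A nonzero vector of the subspace is \<open>c v\<close> with \<open>c \<noteq> 0\<close>, and rescaling it by \<open>d / c\<close> reaches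
  every vector \<open>d v\<close> of the line.\<close>
lemma subspace_of_line:
  assumes v: "v \<in> carrier V" and W: "VectorSpace.subspace class_ring W (V\<lparr>carrier := line V v\<rparr>)"
  shows "W = {\<zero>\<^bsub>V\<^esub>} \<or> W = line V v"
proof (cases "W = {\<zero>\<^bsub>V\<^esub>}")
  case False
  from W interpret W: submodule class_ring W "V\<lparr>carrier := line V v\<rparr>"
    by (simp add: VectorSpace.subspace_def)
  have sub: "W \<subseteq> line V v" using W.subset by simp
  have "\<zero>\<^bsub>V\<^esub> \<in> W" using W.zero_closed by simp
  with False obtain w where w: "w \<in> W" "w \<noteq> \<zero>\<^bsub>V\<^esub>" by blast
  then obtain c where c: "w = c \<odot>\<^bsub>V\<^esub> v" using sub by (auto simp: line_def)
  have "c \<noteq> 0" using w c v by (auto simp: vec_zero_smult)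
  have "d \<odot>\<^bsub>V\<^esub> v \<in> W" for d
  proof -
    have "(d / c) \<odot>\<^bsub>V\<^esub> w \<in> W" using W.smult_closed[of "d / c" w] w by simp
    then show ?thesis using \<open>c \<noteq> 0\<close> v by (simp add: c vec_smult_smult)
  qed
  then show ?thesis using sub by (auto simp: line_def)
qed simp

lemma one_dimensional_line:
  assumes v: "v \<in> carrier V" "v \<noteq> \<zero>\<^bsub>V\<^esub>"
  shows "one_dimensional (V\<lparr>carrier := line V v\<rparr>)"
proof -
  let ?L = "V\<lparr>carrier := line V v\<rparr>"
  interpret L: vectorspace class_ring ?L
    by (rule V.subspace_is_vs[OF subspace_line[OF v(1)]])
  have comb: "L.lincomb a {v} = a v \<odot>\<^bsub>V\<^esub> v" for a :: "'v \<Rightarrow> complex"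
  proof -
    have "L.lincomb a {v} = a v \<odot>\<^bsub>?L\<^esub> v \<oplus>\<^bsub>?L\<^esub> (\<Oplus>\<^bsub>?L\<^esub>w\<in>{}. a w \<odot>\<^bsub>?L\<^esub> w)"
      unfolding L.lincomb_def by (rule L.finsum_insert) (auto simp: line_def)
    also have "\<dots> = a v \<odot>\<^bsub>V\<^esub> v"
      unfolding L.finsum_empty using v by simp
    finally show ?thesis .
  qed
  have gen: "L.gen_set {v}"
  proof -
    have "L.span {v} = {L.lincomb a {v} |a. a \<in> {v} \<rightarrow> carrier class_ring}"
      by (rule L.finite_span) (use self_in_line[OF v(1)] in auto)
    also have "\<dots> = {a v \<odot>\<^bsub>V\<^esub> v |a :: 'v \<Rightarrow> complex. True}" by (simp add: comb)
    also have "\<dots> = line V v" by (auto simp: line_def intro: exI[of _ "\<lambda>_. c" for c])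
    finally show ?thesis by simp
  qed
  have indep: "L.lin_indpt {v}"
  proof (rule L.finite_lin_indpt2)
    fix a :: "'v \<Rightarrow> complex" assume "L.lincomb a {v} = \<zero>\<^bsub>?L\<^esub>"
    then have "a v \<odot>\<^bsub>V\<^esub> v = 0 \<odot>\<^bsub>V\<^esub> v" using v by (simp add: comb vec_zero_smult)
    then show "\<forall>w\<in>{v}. a w = \<zero>\<^bsub>class_ring\<^esub>" using v by (simp add: vec_smult_eq_iff)
  qed (use self_in_line[OF v(1)] in auto)
  have "L.fin_dim" unfolding L.fin_dim_def
    using gen self_in_line[OF v(1)] by (intro exI[of _ "{v}"]) simp
  moreover have "L.dim = card {v}"
    by (rule L.dim_basis) (use gen indep self_in_line[OF v(1)] in \<open>simp_all add: L.basis_def\<close>)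
  ultimately show ?thesis
    unfolding one_dimensional_def using L.vectorspace_axioms by simp
qed

end

text \<open>Representations take values in a record of extensional maps, whose operations are here
  unfolded once and for all.\<close>
lemma is_repD:
  assumes \<pi>: "is_rep U V \<pi>"
  shows rep_closed: "h \<in> carrier U \<Longrightarrow> v \<in> carrier V \<Longrightarrow> \<pi> h v \<in> carrier V"
    and rep_add_vec: "h \<in> carrier U \<Longrightarrow> v \<in> carrier V \<Longrightarrow> v' \<in> carrier V \<Longrightarrow>
      \<pi> h (v \<oplus>\<^bsub>V\<^esub> v') = \<pi> h v \<oplus>\<^bsub>V\<^esub> \<pi> h v'"
    and rep_smult_vec: "h \<in> carrier U \<Longrightarrow> v \<in> carrier V \<Longrightarrow> \<pi> h (c \<odot>\<^bsub>V\<^esub> v) = c \<odot>\<^bsub>V\<^esub> \<pi> h v"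
    and rep_mult: "h \<in> carrier U \<Longrightarrow> h' \<in> carrier U \<Longrightarrow> \<pi> (h \<otimes>\<^bsub>U\<^esub> h') = compose (carrier V) (\<pi> h) (\<pi> h')"
    and rep_add: "h \<in> carrier U \<Longrightarrow> h' \<in> carrier U \<Longrightarrow> \<pi> (h \<oplus>\<^bsub>U\<^esub> h') = (\<lambda>v\<in>carrier V. \<pi> h v \<oplus>\<^bsub>V\<^esub> \<pi> h' v)"
    and rep_smult: "h \<in> carrier U \<Longrightarrow> \<pi> (c \<odot>\<^bsub>U\<^esub> h) = (\<lambda>v\<in>carrier V. c \<odot>\<^bsub>V\<^esub> \<pi> h v)"
    and rep_one: "\<pi> \<one>\<^bsub>U\<^esub> = (\<lambda>v\<in>carrier V. v)"
proof -
  have hom: "\<pi> \<in> Ring.ring_hom U (End_alg V)" "\<pi> \<in> LinearCombinations.module_hom class_ring U (End_alg V)"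
    using \<pi> by (auto simp: is_rep_def alg_hom_def)
  have mod: "\<pi> h \<in> LinearCombinations.module_hom class_ring V V" if "h \<in> carrier U" for h
    using ring_hom_closed[OF hom(1) that] by (simp add: End_alg_def)
  show "h \<in> carrier U \<Longrightarrow> v \<in> carrier V \<Longrightarrow> \<pi> h v \<in> carrier V"
    using LinearCombinations.module_hom_closed[OF mod] by blast
  show "h \<in> carrier U \<Longrightarrow> v \<in> carrier V \<Longrightarrow> v' \<in> carrier V \<Longrightarrow>
      \<pi> h (v \<oplus>\<^bsub>V\<^esub> v') = \<pi> h v \<oplus>\<^bsub>V\<^esub> \<pi> h v'"
    by (rule LinearCombinations.module_hom_add[OF mod])
  show "h \<in> carrier U \<Longrightarrow> v \<in> carrier V \<Longrightarrow> \<pi> h (c \<odot>\<^bsub>V\<^esub> v) = c \<odot>\<^bsub>V\<^esub> \<pi> h v"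
    by (rule LinearCombinations.module_hom_smult[OF mod]) simp_all
  show "h \<in> carrier U \<Longrightarrow> h' \<in> carrier U \<Longrightarrow> \<pi> (h \<otimes>\<^bsub>U\<^esub> h') = compose (carrier V) (\<pi> h) (\<pi> h')"
    using ring_hom_mult[OF hom(1)] by (simp add: End_alg_def)
  show "h \<in> carrier U \<Longrightarrow> h' \<in> carrier U \<Longrightarrow> \<pi> (h \<oplus>\<^bsub>U\<^esub> h') = (\<lambda>v\<in>carrier V. \<pi> h v \<oplus>\<^bsub>V\<^esub> \<pi> h' v)"
    using ring_hom_add[OF hom(1)] by (simp add: End_alg_def)
  show "h \<in> carrier U \<Longrightarrow> \<pi> (c \<odot>\<^bsub>U\<^esub> h) = (\<lambda>v\<in>carrier V. c \<odot>\<^bsub>V\<^esub> \<pi> h v)"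
    using LinearCombinations.module_hom_smult[OF hom(2), of c h] by (simp add: End_alg_def)
  show "\<pi> \<one>\<^bsub>U\<^esub> = (\<lambda>v\<in>carrier V. v)"
    using ring_hom_one[OF hom(1)] by (simp add: End_alg_def)
qed

lemma is_rep_restrict:
  assumes \<pi>: "is_rep U V \<pi>" and W: "subrep U V \<pi> W"
  shows "is_rep U (V\<lparr>carrier := W\<rparr>) (restrict_rep \<pi> W)"
proof -
  have sub: "submodule class_ring W V" and inv: "\<And>h w. h \<in> carrier U \<Longrightarrow> w \<in> W \<Longrightarrow> \<pi> h w \<in> W"
    using W by (auto simp: subrep_def VectorSpace.subspace_def)
  interpret W: submodule class_ring W V by (rule sub)
  have in_V: "w \<in> carrier V" if "w \<in> W" for w using that W.subset by blast
  have sm: "c \<odot>\<^bsub>V\<^esub> w \<in> W" if "w \<in> W" for c w using W.smult_closed[of c w] that by simp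
  have hom: "restrict_rep \<pi> W h \<in> carrier (End_alg (V\<lparr>carrier := W\<rparr>))" if "h \<in> carrier U" for h
    using that by (auto simp: End_alg_def restrict_rep_def LinearCombinations.module_hom_def in_V inv sm
        rep_add_vec[OF \<pi>] rep_smult_vec[OF \<pi>])
  have "restrict_rep \<pi> W \<in> Ring.ring_hom U (End_alg (V\<lparr>carrier := W\<rparr>))"
    by (rule ring_hom_memI)
      (auto simp: hom, auto simp: End_alg_def restrict_rep_def fun_eq_iff compose_def in_V inv
        rep_mult[OF \<pi>] rep_add[OF \<pi>] rep_one[OF \<pi>])
  moreover have "restrict_rep \<pi> W \<in> LinearCombinations.module_hom class_ring U (End_alg (V\<lparr>carrier := W\<rparr>))"
    unfolding LinearCombinations.module_hom_def
    by (auto simp: hom, auto simp: End_alg_def restrict_rep_def fun_eq_iff in_V inv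
        rep_add[OF \<pi>] rep_smult[OF \<pi>])
  ultimately show ?thesis by (simp add: is_rep_def alg_hom_def)
qed

text \<open>Every subrepresentation is a subspace, and a line has no proper nonzero subspaces.\<close>
lemma irreducible_rep_line:
  assumes V: "vectorspace class_ring V" and \<pi>: "is_rep U V \<pi>"
    and v: "v \<in> carrier V" "v \<noteq> \<zero>\<^bsub>V\<^esub>" and inv: "subrep U V \<pi> (line V v)"
  shows "irreducible_rep U (V\<lparr>carrier := line V v\<rparr>) (restrict_rep \<pi> (line V v))"
  unfolding irreducible_rep_def
proof (intro conjI allI impI)
  show "is_rep U (V\<lparr>carrier := line V v\<rparr>) (restrict_rep \<pi> (line V v))"
    by (rule is_rep_restrict[OF \<pi> inv])
  show "carrier (V\<lparr>carrier := line V v\<rparr>) \<noteq> {\<zero>\<^bsub>V\<lparr>carrier := line V v\<rparr>\<^esub>}"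
    using self_in_line[OF V v(1)] v(2) by auto
  show "W = {\<zero>\<^bsub>V\<lparr>carrier := line V v\<rparr>\<^esub>} \<or> W = carrier (V\<lparr>carrier := line V v\<rparr>)"
    if "subrep U (V\<lparr>carrier := line V v\<rparr>) (restrict_rep \<pi> (line V v)) W" for W
    using subspace_of_line[OF V v(1), of W] that by (simp add: subrep_def)
qed

text \<open>On a line every element acts by a scalar. Any linear map commutes with scalars, so an
  intertwining bijection forces the two scalars to agree; conversely, if they agree, the linear map
  with \<open>v \<mapsto> w\<close> intertwines the actions.\<close>
lemma isomorphic_lines_iff:
  assumes V: "vectorspace class_ring V" and W: "vectorspace class_ring W"
    and \<pi>: "is_rep U V \<pi>" and \<rho>: "is_rep U W \<rho>"
    and v: "v \<in> carrier V" "v \<noteq> \<zero>\<^bsub>V\<^esub>" and w: "w \<in> carrier W" "w \<noteq> \<zero>\<^bsub>W\<^esub>"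
    and act: "\<And>h. h \<in> carrier U \<Longrightarrow> \<pi> h v = \<chi> h \<odot>\<^bsub>V\<^esub> v"
      "\<And>h. h \<in> carrier U \<Longrightarrow> \<rho> h w = \<psi> h \<odot>\<^bsub>W\<^esub> w"
  shows "isomorphic_reps U (V\<lparr>carrier := line V v\<rparr>) (restrict_rep \<pi> (line V v))
      (W\<lparr>carrier := line W w\<rparr>) (restrict_rep \<rho> (line W w))
    \<longleftrightarrow> (\<forall>h\<in>carrier U. \<chi> h = \<psi> h)" (is "?iso \<longleftrightarrow> ?eq")
proof
  have \<rho>act: "\<rho> h (c \<odot>\<^bsub>W\<^esub> w) = (c * \<psi> h) \<odot>\<^bsub>W\<^esub> w" if "h \<in> carrier U" for h c
    using that w by (simp add: rep_smult_vec[OF \<rho>] act vec_smult_smult[OF W])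
  have \<pi>act: "\<pi> h (c \<odot>\<^bsub>V\<^esub> v) = (c * \<chi> h) \<odot>\<^bsub>V\<^esub> v" if "h \<in> carrier U" for h c
    using that v by (simp add: rep_smult_vec[OF \<pi>] act vec_smult_smult[OF V])
  {
    assume ?iso
    then obtain \<phi> where hom: "\<phi> \<in> LinearCombinations.module_hom class_ring (V\<lparr>carrier := line V v\<rparr>) (W\<lparr>carrier := line W w\<rparr>)"
      and bij: "bij_betw \<phi> (line V v) (line W w)"
      and comm: "\<And>h x. h \<in> carrier U \<Longrightarrow> x \<in> line V v \<Longrightarrow>
        \<phi> (restrict_rep \<pi> (line V v) h x) = restrict_rep \<rho> (line W w) h (\<phi> x)"
      by (auto simp: isomorphic_reps_def)
    have sm: "\<phi> (c \<odot>\<^bsub>V\<^esub> v) = c \<odot>\<^bsub>W\<^esub> \<phi> v" for c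
      using LinearCombinations.module_hom_smult[OF hom, of c v] self_in_line[OF V v(1)] by simp
    have "\<phi> v \<in> line W w" using bij self_in_line[OF V v(1)] by (auto simp: bij_betw_def)
    then obtain d where d: "\<phi> v = d \<odot>\<^bsub>W\<^esub> w" by (auto simp: line_def)
    have "d \<noteq> 0"
    proof
      assume "d = 0"
      then have "\<phi> (0 \<odot>\<^bsub>V\<^esub> v) = \<phi> (1 \<odot>\<^bsub>V\<^esub> v)" using w
        by (simp only: sm d) (simp add: vec_smult_smult[OF W])
      then have "0 \<odot>\<^bsub>V\<^esub> v = 1 \<odot>\<^bsub>V\<^esub> v"
        using bij by (auto simp: bij_betw_def line_def dest: inj_onD)
      then show False using vec_smult_eq_iff[OF V v, of 0 1] by simp
    qed
    show ?eq
    proof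
      fix h assume h: "h \<in> carrier U"
      have "(\<chi> h * d) \<odot>\<^bsub>W\<^esub> w = \<phi> (\<pi> h v)"
        using h w by (simp add: act sm d vec_smult_smult[OF W])
      also have "\<dots> = \<rho> h (d \<odot>\<^bsub>W\<^esub> w)"
        using comm[OF h self_in_line[OF V v(1)]] self_in_line[OF V v(1)]
        by (simp add: restrict_rep_def d) (simp add: line_def)
      also have "\<dots> = (d * \<psi> h) \<odot>\<^bsub>W\<^esub> w" by (rule \<rho>act[OF h])
      finally show "\<chi> h = \<psi> h" using \<open>d \<noteq> 0\<close> by (simp add: vec_smult_eq_iff[OF W w])
    qed
  }
  {
    assume eq: ?eq
    \<comment> \<open>The coordinate with respect to \<open>v\<close>, used as the coordinate with respect to \<open>w\<close>.\<close>
    define \<phi> where "\<phi> x = (THE c. x = c \<odot>\<^bsub>V\<^esub> v) \<odot>\<^bsub>W\<^esub> w" for x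
    have \<phi>: "\<phi> (c \<odot>\<^bsub>V\<^esub> v) = c \<odot>\<^bsub>W\<^esub> w" for c
      by (simp add: \<phi>_def vec_smult_eq_iff[OF V v])
    have "\<phi> \<in> LinearCombinations.module_hom class_ring (V\<lparr>carrier := line V v\<rparr>) (W\<lparr>carrier := line W w\<rparr>)"
      using v w by (auto simp: LinearCombinations.module_hom_def line_def \<phi> vec_smult_add[OF V]
          vec_smult_add[OF W] vec_smult_smult[OF V] vec_smult_smult[OF W])
    moreover have "bij_betw \<phi> (line V v) (line W w)"
      unfolding bij_betw_def inj_on_def line_def image_image
      by (auto simp: \<phi> vec_smult_eq_iff[OF W w])
    moreover have "\<phi> (restrict_rep \<pi> (line V v) h x) = restrict_rep \<rho> (line W w) h (\<phi> x)"
      if "h \<in> carrier U" "x \<in> line V v" for h x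
      using that eq by (auto simp: line_def restrict_rep_def \<phi> \<pi>act \<rho>act vec_smult_eq_iff[OF W w])
    ultimately show ?iso unfolding isomorphic_reps_def by (intro exI[of _ \<phi>]) simp
  }
qed

text \<open>A common eigenvector of the generators is an eigenvector of every word in them, with the
  product of the eigenvalues, and hence of every linear combination of words. This is what makes it
  enough to know the action of the generators.\<close>
lemma quot_alg_rep_eigenvector:
  assumes V: "vectorspace class_ring V" and \<pi>: "is_rep (quot_alg S) V \<pi>" and v: "v \<in> carrier V"
    and gens: "\<And>g. \<pi> (rel_class S (gen g)) v = \<chi> g \<odot>\<^bsub>V\<^esub> v"
  shows "\<pi> (rel_class S h) v = free_lift (\<lambda>c. c) \<chi> h \<odot>\<^bsub>V\<^esub> v"
proof -
  interpret V: vectorspace class_ring V by (rule V)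
  have cl: "rel_class S a \<in> carrier (quot_alg S)" for a by (simp add: carrier_quot_alg)
  have mult: "\<pi> (rel_class S (a * b)) v = \<pi> (rel_class S a) (\<pi> (rel_class S b) v)" for a b
    using v by (simp add: rep_mult[OF \<pi> cl cl] compose_def flip: mult_quot_alg)
  have word: "\<pi> (rel_class S (Poly_Mapping.single w 1)) v = prod_list (map \<chi> w) \<odot>\<^bsub>V\<^esub> v" for w
  proof (induction w)
    case Nil
    have "Poly_Mapping.single [] 1 = (1 :: 'b free_alg)" by (metis single_one zero_list_def)
    then show ?case using v by (simp add: rep_one[OF \<pi>] vec_smult_one[OF V] flip: one_quot_alg)
  next
    case (Cons g w)
    have "\<pi> (rel_class S (Poly_Mapping.single (g # w) 1)) v
        = \<pi> (rel_class S (gen g)) (prod_list (map \<chi> w) \<odot>\<^bsub>V\<^esub> v)"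
      using mult[of "gen g" "Poly_Mapping.single w 1"] by (simp only: gen_mult_single Cons.IH)
    also have "\<dots> = prod_list (map \<chi> w) \<odot>\<^bsub>V\<^esub> (\<chi> g \<odot>\<^bsub>V\<^esub> v)"
      using v by (simp add: rep_smult_vec[OF \<pi> cl] gens)
    finally show ?case using v by (simp add: vec_smult_smult[OF V] mult.commute)
  qed
  have single: "\<pi> (rel_class S (Poly_Mapping.single w c)) v = (c * prod_list (map \<chi> w)) \<odot>\<^bsub>V\<^esub> v" for w c
  proof -
    have "rel_class S (Poly_Mapping.single w c) = c \<odot>\<^bsub>quot_alg S\<^esub> rel_class S (Poly_Mapping.single w 1)"
      by (simp add: smult_quot_alg mult_single)
    then show ?thesis using v by (simp add: rep_smult[OF \<pi> cl] word vec_smult_smult[OF V])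
  qed
  have "\<pi> (rel_class S (\<Sum>w\<in>A. Poly_Mapping.single w (f w))) v
      = (\<Sum>w\<in>A. f w * prod_list (map \<chi> w)) \<odot>\<^bsub>V\<^esub> v" if "finite A" for A f
    using that
  proof (induction A rule: finite_induct)
    case empty
    show ?case using single[of "[]" 0] by simp
  next
    case (insert w A)
    then show ?case using v
      by (simp add: rep_add[OF \<pi> cl cl] single vec_smult_add[OF V] flip: add_quot_alg)
  qed
  from this[of "Poly_Mapping.keys h" "Poly_Mapping.lookup h"] show ?thesis
    by (simp add: poly_mapping_eq_sum_single free_lift_def)
qed

section \<open>The monomial basis of the quantum plane\<close>

definition lin_ext :: "('m \<Rightarrow> complex) \<Rightarrow> ('m \<Rightarrow>\<^sub>0 complex) \<Rightarrow> complex"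
  where "lin_ext \<phi> h = (\<Sum>w\<in>Poly_Mapping.keys h. Poly_Mapping.lookup h w * \<phi> w)"

lemma lin_ext_superset:
  assumes "finite A" "Poly_Mapping.keys h \<subseteq> A"
  shows "lin_ext \<phi> h = (\<Sum>w\<in>A. Poly_Mapping.lookup h w * \<phi> w)"
  unfolding lin_ext_def using assms
  by (intro sum.mono_neutral_left) (auto simp: not_in_keys_iff_lookup_eq_zero)

lemma lin_ext_zero: "lin_ext \<phi> 0 = 0"
  by (simp add: lin_ext_def)

lemma lin_ext_add: "lin_ext \<phi> (a + b) = lin_ext \<phi> a + lin_ext \<phi> b"
  by (subst (1 2 3) lin_ext_superset[of "Poly_Mapping.keys a \<union> Poly_Mapping.keys b"])
    (auto simp: lookup_add distrib_right sum.distrib dest: subsetD[OF Poly_Mapping.keys_add])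

lemma lin_ext_diff: "lin_ext \<phi> (a - b) = lin_ext \<phi> a - lin_ext \<phi> b"
  using lin_ext_add[of \<phi> "a - b" b] by simp

lemma lin_ext_sum: "lin_ext \<phi> (\<Sum>i\<in>A. f i) = (\<Sum>i\<in>A. lin_ext \<phi> (f i))"
  by (induction A rule: infinite_finite_induct) (auto simp: lin_ext_zero lin_ext_add)

lemma lin_ext_single: "lin_ext \<phi> (Poly_Mapping.single w c) = c * \<phi> w"
  by (subst lin_ext_superset[of "{w}"]) auto

text \<open>The ideal is spanned by the elements \<open>u r v\<close> with \<open>r\<close> a relation and \<open>u\<close>, \<open>v\<close> monomials. Instead
  of writing its elements in this way, one checks that the elements \<open>h\<close> for which the functional
  vanishes on all \<open>u h v\<close> are closed under the operations that generate the ideal.\<close>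
lemma lin_ext_genideal_eq_zero:
  fixes \<phi> :: "'m::monoid_add \<Rightarrow> complex"
  assumes rel: "\<And>u r v. r \<in> S \<Longrightarrow> lin_ext \<phi> (Poly_Mapping.single u 1 * r * Poly_Mapping.single v 1) = 0"
    and "h \<in> Idl\<^bsub>class_ring\<^esub> S"
  shows "lin_ext \<phi> h = 0"
proof -
  \<comment> \<open>Scaled monomials on both sides make \<open>P\<close> visibly stable under multiplication by a term.\<close>
  define P where "P = {h. \<forall>u v c d. lin_ext \<phi> (Poly_Mapping.single u c * h * Poly_Mapping.single v d) = 0}"
  let ?S = "\<lambda>h. \<Sum>w\<in>Poly_Mapping.keys h. Poly_Mapping.single w (Poly_Mapping.lookup h w)"
  have scal: "lin_ext \<phi> (const c * h) = c * lin_ext \<phi> h" for c and h :: "'m \<Rightarrow>\<^sub>0 complex"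
  proof -
    have "lin_ext \<phi> (const c * ?S h) = c * lin_ext \<phi> (?S h)"
      by (simp only: sum_distrib_left lin_ext_sum mult_single lin_ext_single) (simp add: mult_ac)
    then show ?thesis by (simp only: poly_mapping_eq_sum_single)
  qed
  have "Idl\<^bsub>class_ring\<^esub> S \<subseteq> P"
  proof (rule genideal_class_ring_least)
    show "S \<subseteq> P"
    proof
      fix r assume r: "r \<in> S"
      have eq: "Poly_Mapping.single u c * r * Poly_Mapping.single v d
        = const (d * c) * (Poly_Mapping.single u 1 * r * Poly_Mapping.single v 1)" for u v c d
      proof -
        let ?x = "const c * Poly_Mapping.single u 1 * r * Poly_Mapping.single v 1"
        have "Poly_Mapping.single u c * r * Poly_Mapping.single v d = ?x * const d"
          by (simp add: mult_single mult.assoc)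
        moreover have "?x * const d = const d * ?x" by (rule const_central)
        moreover have "const d * ?x = const (d * c) * (Poly_Mapping.single u 1 * r * Poly_Mapping.single v 1)"
          unfolding const_mult mult.assoc ..
        ultimately show ?thesis by metis
      qed
      show "r \<in> P" unfolding P_def
        by (intro CollectI allI) (subst eq, simp only: scal rel[OF r] mult_zero_right)
    qed
  next
    fix a r assume a: "a \<in> P"
    have "lin_ext \<phi> (Poly_Mapping.single u c * (?S r * a) * Poly_Mapping.single v d) = 0" for u v c d
      using a by (simp only: sum_distrib_left sum_distrib_right lin_ext_sum mult.assoc[symmetric] mult_single)
        (simp add: P_def)
    then show "r * a \<in> P" by (simp add: P_def poly_mapping_eq_sum_single)
    have "lin_ext \<phi> (Poly_Mapping.single u c * (a * ?S r) * Poly_Mapping.single v d) = 0" for u v c d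
    proof -
      have "lin_ext \<phi> (Poly_Mapping.single u c * (a * Poly_Mapping.single w e) * Poly_Mapping.single v d) = 0" for w e
        using a by (simp add: P_def mult.assoc mult_single)
      then show ?thesis by (simp only: sum_distrib_left sum_distrib_right lin_ext_sum) simp
    qed
    then show "a * r \<in> P" by (simp add: P_def poly_mapping_eq_sum_single)
  qed (auto simp: P_def lin_ext_zero lin_ext_add distrib_left distrib_right)
  then have "lin_ext \<phi> (Poly_Mapping.single 0 1 * h * Poly_Mapping.single 0 1) = 0"
    using assms(2) unfolding P_def by blast
  then show ?thesis by simp
qed

text \<open>The number of pairs consisting of an \<open>x\<close> and an earlier \<open>y\<close>: the number of applications of
  \<open>y x = q x y\<close> that sort the word.\<close>
fun inversions :: "qp_gen list \<Rightarrow> nat" where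
  "inversions [] = 0"
| "inversions (Gen_x # w) = inversions w"
| "inversions (Gen_y # w) = count_list w Gen_x + inversions w"

lemma inversions_append:
  "inversions (u @ v) = inversions u + inversions v + count_list u Gen_y * count_list v Gen_x"
  by (induction u rule: inversions.induct) auto

text \<open>Sorting a word \<open>w\<close> with \<open>m\<close> letters \<open>x\<close> and \<open>n\<close> letters \<open>y\<close> gives \<open>q ^ inversions w\<close> times
  \<open>x\<^sup>m y\<^sup>n\<close>. Collecting these contributions over all words gives the coefficient of \<open>x\<^sup>m y\<^sup>n\<close> in the
  normal form of an element, defined before the existence of normal forms is known.\<close>
definition qp_coeff :: "complex \<Rightarrow> nat \<Rightarrow> nat \<Rightarrow> qp_gen free_alg \<Rightarrow> complex"
  where "qp_coeff q m n = lin_ext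
    (\<lambda>w. if count_list w Gen_x = m \<and> count_list w Gen_y = n then q ^ inversions w else 0)"

text \<open>The words \<open>u y x v\<close> and \<open>u x y v\<close> have the same letters, and the first has exactly one
  inversion more. So the coefficients of \<open>u (y x - q x y) v\<close> cancel.\<close>
lemma qp_coeff_ideal:
  assumes "h \<in> Idl\<^bsub>class_ring\<^esub> (qp_rels q)"
  shows "qp_coeff q m n h = 0"
  unfolding qp_coeff_def
proof (rule lin_ext_genideal_eq_zero[OF _ assms])
  fix u r v assume r: "r \<in> qp_rels q"
  have "r = Poly_Mapping.single [Gen_y, Gen_x] 1 - Poly_Mapping.single [Gen_x, Gen_y] q"
    using r by (simp add: qp_rels_def gen_def mult_single plus_list_def zero_list_def)
  then have "Poly_Mapping.single u 1 * r * Poly_Mapping.single v 1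
      = Poly_Mapping.single (u @ [Gen_y, Gen_x] @ v) 1 - Poly_Mapping.single (u @ [Gen_x, Gen_y] @ v) q"
    by (simp add: mult_single plus_list_def left_diff_distrib right_diff_distrib)
  then show "lin_ext (\<lambda>w. if count_list w Gen_x = m \<and> count_list w Gen_y = n then q ^ inversions w else 0)
      (Poly_Mapping.single u 1 * r * Poly_Mapping.single v 1) = 0"
    by (simp only: lin_ext_diff lin_ext_single) (simp add: inversions_append power_add algebra_simps)
qed

lemma qp_coeff_cong:
  assumes "rel_class (qp_rels q) h = rel_class (qp_rels q) h'"
  shows "qp_coeff q m n h = qp_coeff q m n h'"
  using qp_coeff_ideal[of "h - h'" q m n] assms
  by (simp add: rel_class_eq_iff qp_coeff_def lin_ext_diff)

abbreviation free_mono :: "nat \<Rightarrow> nat \<Rightarrow> qp_gen free_alg"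
  where "free_mono m n \<equiv> gen Gen_x ^ m * gen Gen_y ^ n"

lemma gen_power: "gen g ^ n = Poly_Mapping.single (replicate n g) 1"
proof (induction n)
  case 0
  show ?case by (simp flip: single_one zero_list_def)
next
  case (Suc n)
  then show ?case by (simp add: gen_mult_single)
qed

lemma free_mono_eq_single: "free_mono m n = Poly_Mapping.single (replicate m Gen_x @ replicate n Gen_y) 1"
  by (simp add: gen_power mult_single plus_list_def)

lemma inversions_replicate: "inversions (replicate m Gen_x @ replicate n Gen_y) = 0"
proof -
  have "inversions (replicate n Gen_y) = 0" "inversions (replicate m Gen_x) = 0"
    by (induction n) (auto simp: count_list_0_iff, induction m, auto)
  then show ?thesis by (simp add: inversions_append count_list_0_iff)
qed

lemma count_list_replicate: "count_list (replicate n x) y = (if x = y then n else 0)"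
  by (induction n) auto

lemma qp_coeff_free_mono:
  "qp_coeff q m n (const c * free_mono m' n') = (if m' = m \<and> n' = n then c else 0)"
  by (simp add: qp_coeff_def free_mono_eq_single mult_single lin_ext_single inversions_replicate
      count_list_replicate)

lemma rel_class_mult_cong:
  assumes "rel_class S a = rel_class S a'" "rel_class S b = rel_class S b'"
  shows "rel_class S (a * b) = rel_class S (a' * b')"
  using assms by (simp flip: mult_quot_alg)

lemma rel_class_sum_cong:
  assumes "\<And>i. i \<in> A \<Longrightarrow> rel_class S (f i) = rel_class S (g i)"
  shows "rel_class S (\<Sum>i\<in>A. f i) = rel_class S (\<Sum>i\<in>A. g i)"
  using assms
  by (induction A rule: infinite_finite_induct) (simp_all flip: add_quot_alg)

lemma qp_commute_power:
  "rel_class (qp_rels q) (gen Gen_y * gen Gen_x ^ m)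
    = rel_class (qp_rels q) (const (q ^ m) * (gen Gen_x ^ m * gen Gen_y))"
proof (induction m)
  case 0
  show ?case by simp
next
  case (Suc m)
  let ?cl = "rel_class (qp_rels q)" and ?x = "gen Gen_x" and ?y = "gen Gen_y"
  have rel: "?cl (?y * ?x) = ?cl (const q * ?x * ?y)"
    by (simp add: rel_class_eq_iff qp_rels_def genideal_class_ring_closed)
  have "?cl (?y * ?x ^ Suc m) = ?cl ((?y * ?x ^ m) * ?x)"
    by (simp only: power_Suc2 mult.assoc)
  also have "\<dots> = ?cl (const (q ^ m) * ?x ^ m * (?y * ?x))"
    using rel_class_mult_cong[OF Suc.IH refl] by (simp only: mult.assoc)
  also have "\<dots> = ?cl (const (q ^ m) * (?x ^ m * const q) * ?x * ?y)"
    using rel_class_mult_cong[OF refl rel, of "const (q ^ m) * ?x ^ m"] by (simp only: mult.assoc)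
  also have "?x ^ m * const q = const q * ?x ^ m"
    by (rule const_central)
  also have "const (q ^ m) * (const q * ?x ^ m) = const (q ^ Suc m) * ?x ^ m"
    by (simp only: mult.assoc[symmetric] const_mult[symmetric] power_Suc2)
  finally show ?case by (simp only: power_Suc2 mult.assoc)
qed

text \<open>Induction on the word. A letter \<open>x\<close> in front of a sorted word keeps it sorted. A letter \<open>y\<close>
  moves past all the letters \<open>x\<close>, and each of them contributes a factor \<open>q\<close>.\<close>
lemma qp_normal_form_word:
  "rel_class (qp_rels q) (Poly_Mapping.single w 1) = rel_class (qp_rels q)
    (const (q ^ inversions w) * free_mono (count_list w Gen_x) (count_list w Gen_y))"
proof (induction w rule: inversions.induct)
  case 1
  have "Poly_Mapping.single [] 1 = (1 :: qp_gen free_alg)"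
    by (metis single_one zero_list_def)
  then show ?case by simp
next
  case (2 w)
  let ?cl = "rel_class (qp_rels q)" and ?x = "gen Gen_x" and ?y = "gen Gen_y"
  let ?m = "count_list w Gen_x" and ?n = "count_list w Gen_y" and ?c = "const (q ^ inversions w)"
  have "?cl (Poly_Mapping.single (Gen_x # w) 1) = ?cl (?x * ?c * free_mono ?m ?n)"
    using rel_class_mult_cong[OF refl 2, of "gen Gen_x"] by (simp only: gen_mult_single[of _ w] mult.assoc)
  also have "?x * ?c = ?c * ?x" by (rule const_central)
  finally show ?case by (simp add: mult.assoc)
next
  case (3 w)
  let ?cl = "rel_class (qp_rels q)" and ?x = "gen Gen_x" and ?y = "gen Gen_y"
  let ?m = "count_list w Gen_x" and ?n = "count_list w Gen_y" and ?c = "const (q ^ inversions w)"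
  have "?cl (Poly_Mapping.single (Gen_y # w) 1) = ?cl (?y * ?c * free_mono ?m ?n)"
    using rel_class_mult_cong[OF refl 3, of "gen Gen_y"] by (simp only: gen_mult_single[of _ w] mult.assoc)
  also have "?y * ?c = ?c * ?y" by (rule const_central)
  also have "?cl (?c * ?y * free_mono ?m ?n) = ?cl (?c * ((?y * ?x ^ ?m) * ?y ^ ?n))"
    by (simp only: mult.assoc)
  also have "\<dots> = ?cl (?c * ((const (q ^ ?m) * (?x ^ ?m * ?y)) * ?y ^ ?n))"
    by (intro rel_class_mult_cong refl qp_commute_power)
  also have "?c * ((const (q ^ ?m) * (?x ^ ?m * ?y)) * ?y ^ ?n)
      = const (q ^ inversions w * q ^ ?m) * free_mono ?m (Suc ?n)"
    by (simp only: const_mult mult.assoc power_Suc)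
  finally show ?case by (simp add: power_add mult.commute)
qed

text \<open>The monomials span. The sum may run over any finite set \<open>P\<close> that contains all the bidegrees of
  words in \<open>h\<close>, since the coefficients outside of it vanish.\<close>
lemma qp_expansion:
  assumes P: "finite P" "(\<lambda>w. (count_list w Gen_x, count_list w Gen_y)) ` Poly_Mapping.keys h \<subseteq> P"
  shows "rel_class (qp_rels q) h
    = rel_class (qp_rels q) (\<Sum>(m, n)\<in>P. const (qp_coeff q m n h) * free_mono m n)"
proof -
  let ?cl = "rel_class (qp_rels q)" and ?K = "Poly_Mapping.keys h"
  let ?g = "\<lambda>w. (count_list w Gen_x, count_list w Gen_y)"
  let ?t = "\<lambda>w. const (Poly_Mapping.lookup h w * q ^ inversions w)
    * free_mono (count_list w Gen_x) (count_list w Gen_y)"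
  have "?cl h = ?cl (\<Sum>w\<in>?K. const (Poly_Mapping.lookup h w) * Poly_Mapping.single w 1)"
    by (simp add: mult_single poly_mapping_eq_sum_single)
  also have "\<dots> = ?cl (\<Sum>w\<in>?K. ?t w)"
  proof (rule rel_class_sum_cong)
    fix w
    show "?cl (const (Poly_Mapping.lookup h w) * Poly_Mapping.single w 1) = ?cl (?t w)"
      using rel_class_mult_cong[OF refl qp_normal_form_word[of q w], of "const (Poly_Mapping.lookup h w)"]
      by (simp only: const_mult mult.assoc)
  qed
  also have "(\<Sum>w\<in>?K. ?t w) = (\<Sum>p\<in>P. \<Sum>w\<in>{w \<in> ?K. ?g w = p}. ?t w)"
    by (rule sum.group[symmetric]) (use P in auto)
  also have "\<dots> = (\<Sum>(m, n)\<in>P. const (qp_coeff q m n h) * free_mono m n)"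
  proof (rule sum.cong[OF refl])
    fix p :: "nat \<times> nat"
    obtain m n where p: "p = (m, n)" by (cases p)
    have const_sum: "const (\<Sum>w\<in>A. f w) = (\<Sum>w\<in>A. const (f w) :: qp_gen free_alg)"
      for A :: "qp_gen list set" and f
      by (induction A rule: infinite_finite_induct) (auto simp: single_add)
    have "qp_coeff q m n h = (\<Sum>w\<in>{w \<in> ?K. count_list w Gen_x = m \<and> count_list w Gen_y = n}.
        Poly_Mapping.lookup h w * q ^ inversions w)"
      unfolding qp_coeff_def lin_ext_def
      by (rule sum.mono_neutral_cong_right) auto
    then show "(\<Sum>w\<in>{w \<in> ?K. ?g w = p}. ?t w)
        = (case p of (m, n) \<Rightarrow> const (qp_coeff q m n h) * free_mono m n)"
      by (simp add: p const_sum sum_distrib_right)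
  qed
  finally show ?thesis .
qed

lemma qp_mono_eq: "qp_mono q m n = rel_class (qp_rels q) (free_mono m n)"
  by (simp add: qp_mono_def qplane_def qp_x_def qp_y_def pow_quot_alg mult_quot_alg)

lemma qp_line_eq: "qp_line q m n = range (\<lambda>c. rel_class (qp_rels q) (const c * free_mono m n))"
  by (simp add: qp_line_def line_def qp_mono_eq qplane_def smult_quot_alg)

lemma qp_term_eq_zero_iff:
  "rel_class (qp_rels q) (const c * free_mono m n) = \<zero>\<^bsub>qplane q\<^esub> \<longleftrightarrow> c = 0"
proof
  assume "rel_class (qp_rels q) (const c * free_mono m n) = \<zero>\<^bsub>qplane q\<^esub>"
  then have "qp_coeff q m n (const c * free_mono m n) = qp_coeff q m n 0"
    by (intro qp_coeff_cong) (simp add: qplane_def zero_quot_alg)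
  then show "c = 0" by (simp only: qp_coeff_free_mono) (simp add: qp_coeff_def lin_ext_zero)
qed (simp add: qplane_def zero_quot_alg)

text \<open>Existence of a decomposition is the expansion in monomials. Uniqueness holds since
  \<^const>\<open>qp_coeff\<close> is well defined on classes and reads off each coefficient of a linear
  combination of monomials.\<close>
lemma qplane_direct_sum: "internal_direct_sum (qplane q) UNIV (\<lambda>(m, n). qp_line q m n)"
  unfolding internal_direct_sum_def
proof (intro conjI ballI)
  interpret V: vectorspace class_ring "qplane q"
    unfolding qplane_def by (rule vectorspace_quot_alg)
  let ?E = "\<lambda>c (m, n). rel_class (qp_rels q) (const c * free_mono m n)"
  have nz: "?E c p \<noteq> \<zero>\<^bsub>qplane q\<^esub> \<longleftrightarrow> c \<noteq> 0" for c p
    by (cases p) (simp add: qp_term_eq_zero_iff)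
  have fs: "(\<Oplus>\<^bsub>qplane q\<^esub>p\<in>A. ?E (c p) p)
      = rel_class (qp_rels q) (\<Sum>p\<in>A. case p of (m, n) \<Rightarrow> const (c p) * free_mono m n)"
    for A c
    using finsum_quot_alg[of "qp_rels q" "\<lambda>p. case p of (m, n) \<Rightarrow> const (c p) * free_mono m n" A]
    by (simp add: qplane_def prod.case_distrib)
  fix v assume "v \<in> carrier (qplane q)"
  then obtain h where v: "v = rel_class (qp_rels q) h"
    by (auto simp: qplane_def carrier_quot_alg)
  let ?d = "\<lambda>p. case p of (m, n) \<Rightarrow> qp_coeff q m n h"
  show "\<exists>!w. w \<in> (\<Pi>\<^sub>E p\<in>UNIV. case p of (m, n) \<Rightarrow> qp_line q m n) \<and>
      finite {p \<in> UNIV. w p \<noteq> \<zero>\<^bsub>qplane q\<^esub>} \<and>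
      v = (\<Oplus>\<^bsub>qplane q\<^esub>p\<in>{p \<in> UNIV. w p \<noteq> \<zero>\<^bsub>qplane q\<^esub>}. w p)"
  proof (rule ex1I[of _ "\<lambda>p. ?E (?d p) p"], intro conjI)
    let ?P = "(\<lambda>w. (count_list w Gen_x, count_list w Gen_y)) ` Poly_Mapping.keys h"
    let ?A = "{p \<in> UNIV. ?E (?d p) p \<noteq> \<zero>\<^bsub>qplane q\<^esub>}"
    show "(\<lambda>p. ?E (?d p) p) \<in> (\<Pi>\<^sub>E p\<in>UNIV. case p of (m, n) \<Rightarrow> qp_line q m n)"
      by (auto simp: PiE_def extensional_def qp_line_eq)
    have A: "?A = {p. ?d p \<noteq> 0}" by (simp add: nz)
    have sub: "{p. ?d p \<noteq> 0} \<subseteq> ?P"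
      by (force simp: qp_coeff_def lin_ext_def intro!: sum.neutral)
    then show "finite ?A" unfolding A by (rule finite_subset) simp
    have "v = rel_class (qp_rels q) (\<Sum>p\<in>?P. case p of (m, n) \<Rightarrow> const (?d p) * free_mono m n)"
      unfolding v by (subst qp_expansion[of ?P]) (auto intro!: arg_cong[of _ _ "rel_class _"] sum.cong)
    also have "(\<Sum>p\<in>?P. case p of (m, n) \<Rightarrow> const (?d p) * free_mono m n)
        = (\<Sum>p\<in>{p. ?d p \<noteq> 0}. case p of (m, n) \<Rightarrow> const (?d p) * free_mono m n)"
      by (rule sum.mono_neutral_right[OF _ sub]) auto
    finally show "v = (\<Oplus>\<^bsub>qplane q\<^esub>p\<in>?A. ?E (?d p) p)" by (simp only: fs A)
  next
    fix w
    assume w: "w \<in> (\<Pi>\<^sub>E p\<in>UNIV. case p of (m, n) \<Rightarrow> qp_line q m n) \<and>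
      finite {p \<in> UNIV. w p \<noteq> \<zero>\<^bsub>qplane q\<^esub>} \<and>
      v = (\<Oplus>\<^bsub>qplane q\<^esub>p\<in>{p \<in> UNIV. w p \<noteq> \<zero>\<^bsub>qplane q\<^esub>}. w p)"
    have "\<exists>c. w p = ?E c p" for p
      using w by (cases p) (simp add: PiE_def Pi_def qp_line_eq image_iff split: prod.splits)
    then obtain c where c: "\<And>p. w p = ?E (c p) p" by metis
    then have weq: "w = (\<lambda>p. ?E (c p) p)" by blast
    let ?A = "{p. c p \<noteq> 0}"
    have A: "{p \<in> UNIV. w p \<noteq> \<zero>\<^bsub>qplane q\<^esub>} = ?A"
      using nz by (simp add: c)
    have fin: "finite ?A" using w unfolding A by blast
    have "v = (\<Oplus>\<^bsub>qplane q\<^esub>p\<in>?A. w p)" using w unfolding A by blast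
    then have "v = (\<Oplus>\<^bsub>qplane q\<^esub>p\<in>?A. ?E (c p) p)" by (subst (asm) weq)
    then have h: "rel_class (qp_rels q) h
        = rel_class (qp_rels q) (\<Sum>p\<in>?A. case p of (m, n) \<Rightarrow> const (c p) * free_mono m n)"
      by (simp only: v fs)
    have "qp_coeff q m n h = c (m, n)" for m n
    proof -
      have "qp_coeff q m n h
          = (\<Sum>p\<in>?A. qp_coeff q m n (case p of (m, n) \<Rightarrow> const (c p) * free_mono m n))"
        unfolding qp_coeff_cong[OF h] by (simp only: qp_coeff_def lin_ext_sum)
      also have "\<dots> = (\<Sum>p\<in>?A. if p = (m, n) then c p else 0)"
        by (intro sum.cong refl) (auto simp: qp_coeff_free_mono split: prod.splits)
      also have "\<dots> = c (m, n)" using fin by (simp add: sum.delta)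
      finally show ?thesis .
    qed
    then show "w = (\<lambda>p. ?E (?d p) p)" by (auto simp: weq)
  qed
next
  interpret V: vectorspace class_ring "qplane q"
    unfolding qplane_def by (rule vectorspace_quot_alg)
  fix p :: "nat \<times> nat"
  show "VectorSpace.subspace class_ring (case p of (m, n) \<Rightarrow> qp_line q m n) (qplane q)"
    using subspace_line[OF V.vectorspace_axioms]
    by (cases p) (simp add: qp_line_def qp_mono_eq qplane_def carrier_quot_alg)
qed

section \<open>The action of the quantum group on monomials\<close>

lemma uq_class_in_carrier: "uq_class q h \<in> carrier (Uq q)"
  by (simp add: Uq_def uq_class_def carrier_quot_alg)

lemma module_algebra_sweedler:
  assumes "q \<noteq> 0" and \<pi>: "uq_module_algebra q A \<pi>"
    and h: "free_lift const comult_gen h = (\<Sum>i<n. tens (h' i) (h'' i))"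
    and "a \<in> carrier A" "b \<in> carrier A"
  shows "\<pi> (uq_class q h) (a \<otimes>\<^bsub>A\<^esub> b) =
    (\<Oplus>\<^bsub>A\<^esub>i\<in>{..<n::nat}. \<pi> (uq_class q (h' i)) a \<otimes>\<^bsub>A\<^esub> \<pi> (uq_class q (h'' i)) b)"
proof -
  have "uq_comult q (uq_class q h) = uq2_class q (\<Sum>i<n. tens (h' i) (h'' i))"
    by (simp only: uq_comult_class[OF assms(1)] h)
  then show ?thesis using assms uq_class_in_carrier[of q h] by (simp add: uq_module_algebra_def)
qed

text \<open>Zero, or a weight vector that is both of highest and of lowest weight.\<close>
definition extremal_vector ::
    "complex \<Rightarrow> (complex, 'v) module \<Rightarrow> (uq_gen free_alg set \<Rightarrow> 'v \<Rightarrow> 'v) \<Rightarrow> complex \<Rightarrow> 'v \<Rightarrow> bool"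
  where "extremal_vector q V \<pi> c v \<longleftrightarrow> v \<in> carrier V \<and> \<pi> (uq_k q) v = c \<odot>\<^bsub>V\<^esub> v \<and>
    \<pi> (uq_e q) v = \<zero>\<^bsub>V\<^esub> \<and> \<pi> (uq_f q) v = \<zero>\<^bsub>V\<^esub>"

text \<open>The eigenvalues of the generators on an extremal vector of weight \<open>c\<close>.\<close>
fun extremal_char :: "complex \<Rightarrow> uq_gen \<Rightarrow> complex" where
  "extremal_char c Gen_k = c"
| "extremal_char c Gen_kinv = inverse c"
| "extremal_char c Gen_e = 0"
| "extremal_char c Gen_f = 0"

text \<open>By definition \<open>k\<close>, \<open>e\<close> and \<open>f\<close> act by scalars. The scalar for \<open>k\<^sup>-\<^sup>1\<close> is forced by
  \<open>k\<^sup>-\<^sup>1 k = 1\<close>, and then every element acts by a scalar that depends on the weight only.\<close>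
lemma extremal_vector_action:
  assumes V: "vectorspace class_ring V" and \<pi>: "is_rep (Uq q) V \<pi>"
    and v: "extremal_vector q V \<pi> c v" and c: "c \<noteq> 0"
  shows "\<pi> (uq_class q h) v = free_lift (\<lambda>c. c) (extremal_char c) h \<odot>\<^bsub>V\<^esub> v"
proof -
  interpret V: vectorspace class_ring V by (rule V)
  have carr: "v \<in> carrier V" using v by (simp add: extremal_vector_def)
  have "uq_class q (gen Gen_kinv) \<otimes>\<^bsub>Uq q\<^esub> uq_k q = \<one>\<^bsub>Uq q\<^esub>"
    by (simp add: Uq_def uq_k_def uq_class_def mult_quot_alg one_quot_alg rel_class_eq_iff
        uq_rels_def Let_def genideal_class_ring_closed)
  then have "\<pi> (uq_class q (gen Gen_kinv) \<otimes>\<^bsub>Uq q\<^esub> uq_k q) v = v"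
    using carr by (simp add: rep_one[OF \<pi>])
  then have "c \<odot>\<^bsub>V\<^esub> \<pi> (uq_class q (gen Gen_kinv)) v = v"
    using carr v
    by (simp add: uq_k_def rep_mult[OF \<pi> uq_class_in_carrier uq_class_in_carrier] compose_def
        extremal_vector_def rep_smult_vec[OF \<pi> uq_class_in_carrier])
  then have "inverse c \<odot>\<^bsub>V\<^esub> (c \<odot>\<^bsub>V\<^esub> \<pi> (uq_class q (gen Gen_kinv)) v) = inverse c \<odot>\<^bsub>V\<^esub> v"
    by simp
  then have kinv: "\<pi> (uq_class q (gen Gen_kinv)) v = inverse c \<odot>\<^bsub>V\<^esub> v"
    using c rep_closed[OF \<pi> uq_class_in_carrier carr] by (simp add: vec_smult_smult[OF V] vec_smult_one[OF V])
  have "\<pi> (rel_class (uq_rels q) (gen g)) v = extremal_char c g \<odot>\<^bsub>V\<^esub> v" for g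
    using v kinv carr
    by (cases g) (simp_all add: extremal_vector_def uq_k_def uq_e_def uq_f_def uq_class_def vec_zero_smult[OF V])
  from quot_alg_rep_eigenvector[OF V \<pi>[unfolded Uq_def] carr this]
  show ?thesis by (simp add: uq_class_def)
qed

context
  fixes q :: complex and S :: "('m::monoid_add \<Rightarrow>\<^sub>0 complex) set"
    and \<pi> :: "uq_gen free_alg set \<Rightarrow> ('m \<Rightarrow>\<^sub>0 complex) set \<Rightarrow> ('m \<Rightarrow>\<^sub>0 complex) set"
  assumes q: "q \<noteq> 0" and ma: "uq_module_algebra q (quot_alg S) \<pi>"
begin

lemma module_algebra_is_rep: "is_rep (Uq q) (quot_alg S) \<pi>"
  using ma by (simp add: uq_module_algebra_def)

lemma extremal_vector_one: "extremal_vector q (quot_alg S) \<pi> 1 \<one>\<^bsub>quot_alg S\<^esub>"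
proof -
  interpret V: vectorspace class_ring "quot_alg S" by (rule vectorspace_quot_alg)
  have one: "\<one>\<^bsub>quot_alg S\<^esub> \<in> carrier (quot_alg S)" by (simp add: one_quot_alg carrier_quot_alg)
  have "\<pi> (uq_class q h) \<one>\<^bsub>quot_alg S\<^esub> = free_lift (\<lambda>c. c) counit_gen h \<odot>\<^bsub>quot_alg S\<^esub> \<one>\<^bsub>quot_alg S\<^esub>" for h
    using ma uq_class_in_carrier by (simp add: uq_module_algebra_def flip: uq_counit_class[of q])
  then show ?thesis using one
    by (simp add: extremal_vector_def uq_k_def uq_e_def uq_f_def counit_gen_eq vec_zero_smult[OF vectorspace_quot_alg])
qed

text \<open>By the comultiplication, \<open>k (a b) = k(a) k(b)\<close>, and each term of \<open>e (a b) = a e(b) + e(a) k(b)\<close>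
  and \<open>f (a b) = f(a) b + k\<^sup>-\<^sup>1(a) f(b)\<close> has a vanishing factor.\<close>
lemma extremal_vector_mult:
  assumes a: "extremal_vector q (quot_alg S) \<pi> c a" and b: "extremal_vector q (quot_alg S) \<pi> d b"
  shows "extremal_vector q (quot_alg S) \<pi> (c * d) (a \<otimes>\<^bsub>quot_alg S\<^esub> b)"
proof -
  let ?A = "quot_alg S"
  interpret V: vectorspace class_ring ?A by (rule vectorspace_quot_alg)
  have carr: "a \<in> carrier ?A" "b \<in> carrier ?A" using a b by (auto simp: extremal_vector_def)
  have mc: "x \<otimes>\<^bsub>?A\<^esub> y \<in> carrier ?A" if "x \<in> carrier ?A" "y \<in> carrier ?A" for x y
    using that by (auto simp: carrier_quot_alg mult_quot_alg)
  have zl: "\<zero>\<^bsub>?A\<^esub> \<otimes>\<^bsub>?A\<^esub> x = \<zero>\<^bsub>?A\<^esub>" and zr: "x \<otimes>\<^bsub>?A\<^esub> \<zero>\<^bsub>?A\<^esub> = \<zero>\<^bsub>?A\<^esub>" if "x \<in> carrier ?A" for x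
    using that by (auto simp: carrier_quot_alg quot_alg_simps)
  have sm: "(c \<odot>\<^bsub>?A\<^esub> x) \<otimes>\<^bsub>?A\<^esub> (d \<odot>\<^bsub>?A\<^esub> y) = (c * d) \<odot>\<^bsub>?A\<^esub> (x \<otimes>\<^bsub>?A\<^esub> y)"
    if "x \<in> carrier ?A" "y \<in> carrier ?A" for c d x y
  proof -
    obtain u v where "x = rel_class S u" "y = rel_class S v"
      using \<open>x \<in> carrier ?A\<close> \<open>y \<in> carrier ?A\<close> by (auto simp: carrier_quot_alg)
    moreover have "const c * u * (const d * v) = const (c * d) * (u * v)"
    proof -
      have "const c * u * (const d * v) = const c * (u * const d) * v" by (simp only: mult.assoc)
      also have "u * const d = const d * u" by (rule const_central)
      finally show ?thesis by (simp only: mult.assoc const_mult)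
    qed
    ultimately show ?thesis by (simp add: quot_alg_simps)
  qed
  have act: "\<pi> (uq_class q h) x \<in> carrier ?A" if "x \<in> carrier ?A" for h x
    by (rule rep_closed[OF module_algebra_is_rep uq_class_in_carrier that])
  have one: "\<pi> (uq_class q 1) x = x" if "x \<in> carrier ?A" for x
    using rep_one[OF module_algebra_is_rep] that by (simp add: Uq_def one_quot_alg uq_class_def)
  have two: "\<pi> (uq_class q h) (a \<otimes>\<^bsub>?A\<^esub> b) = \<pi> (uq_class q h1) a \<otimes>\<^bsub>?A\<^esub> \<pi> (uq_class q h1') b
      \<oplus>\<^bsub>?A\<^esub> \<pi> (uq_class q h2) a \<otimes>\<^bsub>?A\<^esub> \<pi> (uq_class q h2') b"
    if "free_lift const comult_gen h = tens h1 h1' + tens h2 h2'" for h h1 h1' h2 h2'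
  proof -
    \<comment> \<open>A sum over \<open>{..<2}\<close> unfolds with the index \<open>1\<close> first, so \<open>1\<close> is the index of the first term.\<close>
    let ?l = "\<lambda>i::nat. if i = 0 then h2 else h1" and ?r = "\<lambda>i::nat. if i = 0 then h2' else h1'"
    have "free_lift const comult_gen h = (\<Sum>i<2. tens (?l i) (?r i))"
      by (simp add: that numeral_2_eq_2 add.commute)
    from module_algebra_sweedler[OF q ma this carr] show ?thesis
      by (simp add: numeral_2_eq_2 lessThan_Suc mc act carr)
  qed
  have "free_lift const comult_gen (gen Gen_k) = (\<Sum>i<1::nat. tens (gen Gen_k) (gen Gen_k))"
    by (simp add: comult_gen_eq)
  from module_algebra_sweedler[OF q ma this carr]
  have "\<pi> (uq_k q) (a \<otimes>\<^bsub>?A\<^esub> b) = \<pi> (uq_k q) a \<otimes>\<^bsub>?A\<^esub> \<pi> (uq_k q) b"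
    by (simp add: lessThan_Suc mc act carr uq_k_def)
  moreover have "\<pi> (uq_e q) (a \<otimes>\<^bsub>?A\<^esub> b) = a \<otimes>\<^bsub>?A\<^esub> \<pi> (uq_e q) b \<oplus>\<^bsub>?A\<^esub> \<pi> (uq_e q) a \<otimes>\<^bsub>?A\<^esub> \<pi> (uq_k q) b"
    using two[of "gen Gen_e" 1 "gen Gen_e" "gen Gen_e" "gen Gen_k"] carr
    by (simp add: comult_gen_eq one uq_e_def uq_k_def)
  moreover have "\<pi> (uq_f q) (a \<otimes>\<^bsub>?A\<^esub> b)
      = \<pi> (uq_f q) a \<otimes>\<^bsub>?A\<^esub> b \<oplus>\<^bsub>?A\<^esub> \<pi> (uq_class q (gen Gen_kinv)) a \<otimes>\<^bsub>?A\<^esub> \<pi> (uq_f q) b"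
    using two[of "gen Gen_f" "gen Gen_f" 1 "gen Gen_kinv" "gen Gen_f"] carr
    by (simp add: comult_gen_eq one uq_f_def)
  ultimately show ?thesis
    using a b act[of a "gen Gen_kinv"] by (simp add: extremal_vector_def sm mc zl zr)
qed

lemma extremal_vector_power:
  assumes "extremal_vector q (quot_alg S) \<pi> c a"
  shows "extremal_vector q (quot_alg S) \<pi> (c ^ n) (a [^]\<^bsub>quot_alg S\<^esub> (n::nat))"
proof (induction n)
  case 0
  show ?case using extremal_vector_one by simp
next
  case (Suc n)
  then show ?case using extremal_vector_mult[OF Suc.IH assms] by (simp add: mult.commute)
qed

end

theorem proposition17:
  fixes q \<alpha> \<beta> :: complex
    and \<pi> :: "uq_gen free_alg set \<Rightarrow> qp_gen free_alg set \<Rightarrow> qp_gen free_alg set"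
  assumes q_nonzero: "q \<noteq> 0"
    and q_not_root_of_unity: "\<forall>n::nat. n > 0 \<longrightarrow> q ^ n \<noteq> 1"
    and module_algebra: "uq_module_algebra q (qplane q) \<pi>"
    and signs: "\<alpha> \<in> {1, -1}" "\<beta> \<in> {1, -1}"
    and k_action: "\<pi> (uq_k q) (qp_x q) = \<alpha> \<odot>\<^bsub>qplane q\<^esub> qp_x q"
      "\<pi> (uq_k q) (qp_y q) = \<beta> \<odot>\<^bsub>qplane q\<^esub> qp_y q"
    and e_action: "\<pi> (uq_e q) (qp_x q) = \<zero>\<^bsub>qplane q\<^esub>" "\<pi> (uq_e q) (qp_y q) = \<zero>\<^bsub>qplane q\<^esub>"
    and f_action: "\<pi> (uq_f q) (qp_x q) = \<zero>\<^bsub>qplane q\<^esub>" "\<pi> (uq_f q) (qp_y q) = \<zero>\<^bsub>qplane q\<^esub>"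
  shows "internal_direct_sum (qplane q) UNIV (\<lambda>(m, n). qp_line q m n) \<and>
    (\<forall>m n. subrep (Uq q) (qplane q) \<pi> (qp_line q m n)
      \<and> one_dimensional ((qplane q)\<lparr>carrier := qp_line q m n\<rparr>)
      \<and> irreducible_rep (Uq q) ((qplane q)\<lparr>carrier := qp_line q m n\<rparr>)
          (restrict_rep \<pi> (qp_line q m n))) \<and>
    (\<forall>m n. \<pi> (uq_k q) (qp_mono q m n) = (\<alpha> ^ m * \<beta> ^ n) \<odot>\<^bsub>qplane q\<^esub> qp_mono q m n
      \<and> \<alpha> ^ m * \<beta> ^ n \<in> {1, -1}) \<and>
    (\<forall>m n m' n'.
      isomorphic_reps (Uq q)
        ((qplane q)\<lparr>carrier := qp_line q m n\<rparr>) (restrict_rep \<pi> (qp_line q m n))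
        ((qplane q)\<lparr>carrier := qp_line q m' n'\<rparr>) (restrict_rep \<pi> (qp_line q m' n'))
      \<longleftrightarrow> \<alpha> ^ m * \<beta> ^ n = \<alpha> ^ m' * \<beta> ^ n')"
proof (intro conjI allI qplane_direct_sum)
  let ?A = "qplane q" and ?wt = "\<lambda>m n. \<alpha> ^ m * \<beta> ^ n"
  have V: "vectorspace class_ring ?A" unfolding qplane_def by (rule vectorspace_quot_alg)
  interpret V: vectorspace class_ring ?A by (rule V)
  have rep: "is_rep (Uq q) ?A \<pi>" using module_algebra by (simp add: uq_module_algebra_def)
  note ma = module_algebra[unfolded qplane_def]
  have x: "extremal_vector q ?A \<pi> \<alpha> (qp_x q)" and y: "extremal_vector q ?A \<pi> \<beta> (qp_y q)"
    using k_action e_action f_action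
    by (simp_all add: extremal_vector_def qplane_def qp_x_def qp_y_def carrier_quot_alg)
  have mono: "extremal_vector q ?A \<pi> (?wt m n) (qp_mono q m n)" for m n
    unfolding qp_mono_def
    using extremal_vector_mult[OF q_nonzero ma] extremal_vector_power[OF q_nonzero ma] x y
    by (simp add: qplane_def)
  have carr: "qp_mono q m n \<in> carrier ?A" for m n
    using mono[of m n] by (simp add: extremal_vector_def)
  have nz: "qp_mono q m n \<noteq> \<zero>\<^bsub>?A\<^esub>" for m n
    using qp_term_eq_zero_iff[of q 1 m n] by (simp add: qp_mono_eq)
  show sign: "?wt m n \<in> {1, -1}" for m n
  proof -
    have "\<alpha> ^ m \<in> {1, -1}" "\<beta> ^ n \<in> {1, -1}"
      using signs by (auto simp: minus_one_power_iff split: if_splits)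
    then show ?thesis by auto
  qed
  show "\<pi> (uq_k q) (qp_mono q m n) = ?wt m n \<odot>\<^bsub>?A\<^esub> qp_mono q m n" for m n
    using mono[of m n] by (simp add: extremal_vector_def)
  \<comment> \<open>The scalar by which the class \<open>H\<close> acts in weight \<open>c\<close>, computed from a chosen representative.
    Any choice will do, since \<open>act\<close> below shows the result to be an eigenvalue of \<open>H\<close> itself.\<close>
  define \<chi> where "\<chi> c H = free_lift (\<lambda>c. c) (extremal_char c) (SOME h. H = uq_class q h)" for c H
  have act: "\<pi> H (qp_mono q m n) = \<chi> (?wt m n) H \<odot>\<^bsub>?A\<^esub> qp_mono q m n"
    if "H \<in> carrier (Uq q)" for H m n
  proof -
    have "\<exists>h. H = uq_class q h" using that by (auto simp: Uq_def uq_class_def carrier_quot_alg)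
    then have "H = uq_class q (SOME h. H = uq_class q h)" by (rule someI_ex)
    moreover have "?wt m n \<noteq> 0" using sign[of m n] by force
    ultimately show ?thesis
      using extremal_vector_action[OF V rep mono[of m n], of "SOME h. H = uq_class q h"]
      unfolding \<chi>_def by argo
  qed
  show sub: "subrep (Uq q) ?A \<pi> (qp_line q m n)" for m n
    using subspace_line[OF V carr[of m n]] carr
    by (auto simp: subrep_def qp_line_def line_def rep_smult_vec[OF rep] act vec_smult_smult[OF V])
  show "one_dimensional (?A\<lparr>carrier := qp_line q m n\<rparr>)" for m n
    unfolding qp_line_def by (rule one_dimensional_line[OF V carr nz])
  show "irreducible_rep (Uq q) (?A\<lparr>carrier := qp_line q m n\<rparr>) (restrict_rep \<pi> (qp_line q m n))" for m n
    using irreducible_rep_line[OF V rep carr nz] sub by (simp add: qp_line_def)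
  show "isomorphic_reps (Uq q)
        (?A\<lparr>carrier := qp_line q m n\<rparr>) (restrict_rep \<pi> (qp_line q m n))
        (?A\<lparr>carrier := qp_line q m' n'\<rparr>) (restrict_rep \<pi> (qp_line q m' n'))
      \<longleftrightarrow> ?wt m n = ?wt m' n'" for m n m' n'
  proof -
    have k: "uq_k q \<in> carrier (Uq q)" unfolding uq_k_def by (rule uq_class_in_carrier)
    have "\<chi> (?wt m n) (uq_k q) = ?wt m n" for m n
      using act[OF k, of m n] mono[of m n] vec_smult_eq_iff[OF V carr nz]
      by (simp add: extremal_vector_def)
    then have "(\<forall>H\<in>carrier (Uq q). \<chi> (?wt m n) H = \<chi> (?wt m' n') H) \<longleftrightarrow> ?wt m n = ?wt m' n'"
      using k by metis
    then show ?thesis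
      unfolding qp_line_def
      using isomorphic_lines_iff[OF V V rep rep carr nz carr nz act act] by blast
  qed
qed

end
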